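(* Let $W$ be a $1|2$-dimensional $\mathbb{Z}_2$-graded vector space over $\mathfrak K$, let $m\ge0$ be an integer, let $\lambda\in\mathfrak K$, and let $d_\lambda=\psi^{0,1,m+1}_3+\psi^{1,1,m}_1\lambda\in L_{m+2}$. (1) If $\lambda$ is not of the form $-(n+2)$ with $n$ an integer, $n>m$, then every extension of $d_\lambda$ is equivalent to $d_\lambda$. (2) If $\lambda=-(n+2)$ for an integer $n>m$, then $$d_{\lambda,e}=\psi^{0,1,m+1}_3-\psi^{1,1,m}_1(n+2)+\psi^{0,0,n+2}_1$$ is an extension of $d_\lambda$ which is not equivalent to $d_\lambda$, and every extension of $d_\lambda$ is equivalent either to $d_\lambda$ or to $d_{\lambda,e}$.
   Context: $\mathfrak K$ is an algebraically closed field of characteristic zero. $W=\langle w_1,w_2,w_3\rangle$ is the $\mathbb{Z}_2$-graded vector space with $w_1,w_2$ odd and $w_3$ even. $S(W)=\bigoplus_{n\ge1}S^n(W)$ is the reduced $\mathbb{Z}_2$-graded symmetric algebra (with $uv=(-1)^{uv}vu$), with its coalgebra structure $\Delta(v_1\cdots v_n)=\sum_{k=1}^{n-1}\sum_{\sigma\in \mathrm{Sh}(k,n-k)}\epsilon(\sigma)\,v_{\sigma(1)}\cdots v_{\sigma(k)}\otimes v_{\sigma(k+1)}\cdots v_{\sigma(n)}$, where $\mathrm{Sh}(k,n-k)$ is the set of unshuffles and $\epsilon(\sigma)$ is the sign with $v_{\sigma(1)}\cdots v_{\sigma(n)}=\epsilon(\sigma)v_1\cdots v_n$. Put $L_n=\mathrm{Hom}(S^n(W),W)$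 and $L=\mathrm{Hom}(S(W),W)=\prod_{n\ge1} L_n$. Each $\varphi\in L_k$ extends to a coderivation $\tilde\varphi$ of $S(W)$ by $\tilde\varphi(v_1\cdots v_n)=\sum_{\sigma\in\mathrm{Sh}(k,n-k)}\epsilon(\sigma)\varphi(v_{\sigma(1)}\cdots v_{\sigma(k)})v_{\sigma(k+1)}\cdots v_{\sigma(n)}$, and this identifies $L$ with the coderivations of $S(W)$. The bracket on $L$ is $[\alpha,\beta]=\alpha\tilde\beta-(-1)^{\alpha\beta}\beta\tilde\alpha$. A codifferential (an $L_\infty$ structure on $W$, in the parity-reversed convention) is an odd element $d\in L$ with $[d,d]=0$, equivalently $\tilde d^2=0$. Two codifferentials $d,d'$ are equivalent if there is a parity-preserving coalgebra automorphism $\tilde g$ of $S(W)$ (determined by $g=g_1+g_2+\cdots\in L$, $g_i:S^i(W)\to W$ even, $g_1$ invertible) with $d'=\tilde g^{-1}\circ d\circ\tilde g$. An extension of a codifferential $d_N\in L_N$ is a codifferential $d=d_N+d_{N+1}+\cdots$ with $d_i\in L_i$, whose lowest-degree term is $d_N$ (so $d_N$ is itself an extension of $d_N$). For $I=(i_1,i_2,i_3)$ with $i_1,i_2\in\{0,1\}$, $i_3\ge0$ and $|I|=i_1+i_2+i_3\ge1$, let $w_I=w_1^{i_1}w_2^{i_2}w_3^{i_3}$ and $I!=i_1!i_2!i_3!$. The element $\varphi^I_j\in L_{|I|}$ is defined by $\varphi^I_j(w_J)=I!\,\delta^I_J\,w_j$. It is written $\psi^I_j$ when it is odd. *)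

theory Defs
  imports "HOL-Library.Poly_Mapping" "HOL-Computational_Algebra.Polynomial"
    "HOL-Combinatorics.Permutations"
begin

section \<open>Free vector spaces\<close>

text \<open>The vector space over \<open>'k\<close> with basis \<open>'b\<close> is \<open>'b \<Rightarrow>\<^sub>0 'k\<close>; the basis vector
  of \<open>b\<close> is \<open>Poly_Mapping.single b 1\<close>.\<close>

definition scl :: "'k::field \<Rightarrow> ('b \<Rightarrow>\<^sub>0 'k) \<Rightarrow> ('b \<Rightarrow>\<^sub>0 'k)" where
  "scl c x = Poly_Mapping.map ((*) c) x"

abbreviation lin :: "(('b \<Rightarrow>\<^sub>0 'k::field) \<Rightarrow> ('c \<Rightarrow>\<^sub>0 'k)) \<Rightarrow> bool" where
  "lin f \<equiv> Vector_Spaces.linear scl scl f"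

definition lin_ext :: "('b \<Rightarrow> ('c \<Rightarrow>\<^sub>0 'k::field)) \<Rightarrow> ('b \<Rightarrow>\<^sub>0 'k) \<Rightarrow> ('c \<Rightarrow>\<^sub>0 'k)" where
  "lin_ext f x = (\<Sum>b\<in>Poly_Mapping.keys x. scl (Poly_Mapping.lookup x b) (f b))"

definition tensor :: "('b \<Rightarrow>\<^sub>0 'k::field) \<Rightarrow> ('c \<Rightarrow>\<^sub>0 'k) \<Rightarrow> ('b \<times> 'c \<Rightarrow>\<^sub>0 'k)" where
  "tensor x y = (\<Sum>a\<in>Poly_Mapping.keys x. \<Sum>b\<in>Poly_Mapping.keys y.
     Poly_Mapping.single (a, b) (Poly_Mapping.lookup x a * Poly_Mapping.lookup y b))"

text \<open>The tensor product of two linear maps; no Koszul sign occurs, as it is only used for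
  parity-preserving maps.\<close>

definition tensor_map ::
  "(('b \<Rightarrow>\<^sub>0 'k::field) \<Rightarrow> ('d \<Rightarrow>\<^sub>0 'k)) \<Rightarrow> (('c \<Rightarrow>\<^sub>0 'k) \<Rightarrow> ('e \<Rightarrow>\<^sub>0 'k)) \<Rightarrow>
   ('b \<times> 'c \<Rightarrow>\<^sub>0 'k) \<Rightarrow> ('d \<times> 'e \<Rightarrow>\<^sub>0 'k)" where
  "tensor_map f g =
     lin_ext (\<lambda>(a, b). tensor (f (Poly_Mapping.single a 1)) (g (Poly_Mapping.single b 1)))"

text \<open>A parity function on the basis makes the space \<open>\<int>\<^sub>2\<close>-graded (\<open>True\<close> is odd).\<close>

definition homogeneous :: "('b \<Rightarrow> bool) \<Rightarrow> bool \<Rightarrow> ('b \<Rightarrow>\<^sub>0 'k::zero) \<Rightarrow> bool" where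
  "homogeneous par p x \<longleftrightarrow> (\<forall>b\<in>Poly_Mapping.keys x. par b = p)"

definition even_map ::
  "('b \<Rightarrow> bool) \<Rightarrow> ('c \<Rightarrow> bool) \<Rightarrow> (('b \<Rightarrow>\<^sub>0 'k::field) \<Rightarrow> ('c \<Rightarrow>\<^sub>0 'k)) \<Rightarrow> bool" where
  "even_map par par' f \<longleftrightarrow> (\<forall>p x. homogeneous par p x \<longrightarrow> homogeneous par' p (f x))"

definition odd_map ::
  "('b \<Rightarrow> bool) \<Rightarrow> ('c \<Rightarrow> bool) \<Rightarrow> (('b \<Rightarrow>\<^sub>0 'k::field) \<Rightarrow> ('c \<Rightarrow>\<^sub>0 'k)) \<Rightarrow> bool" where
  "odd_map par par' f \<longleftrightarrow> (\<forall>p x. homogeneous par p x \<longrightarrow> homogeneous par' (\<not> p) (f x))"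

section \<open>The space \<open>W\<close> and its reduced symmetric algebra\<close>

datatype gen = W1 | W2 | W3

fun gen_odd :: "gen \<Rightarrow> bool" where
  "gen_odd W1 = True" | "gen_odd W2 = True" | "gen_odd W3 = False"

type_synonym 'k W = "gen \<Rightarrow>\<^sub>0 'k"

text \<open>The triple \<open>(i\<^sub>1, i\<^sub>2, i\<^sub>3)\<close> stands for the monomial
  \<open>w\<^sub>1\<^sup>i\<^sup>1 w\<^sub>2\<^sup>i\<^sup>2 w\<^sub>3\<^sup>i\<^sup>3\<close>; these monomials form a basis of \<open>S(W)\<close>.\<close>

typedef mon = "{(i1 :: nat, i2 :: nat, i3 :: nat). i1 \<le> 1 \<and> i2 \<le> 1 \<and> i1 + i2 + i3 \<ge> 1}"
  morphisms exponents Mon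
  by (rule exI[of _ "(1, 0, 0)"]) simp

type_synonym 'k SW = "mon \<Rightarrow>\<^sub>0 'k"

definition mon_size :: "mon \<Rightarrow> nat" where
  "mon_size I = (case exponents I of (i1, i2, i3) \<Rightarrow> i1 + i2 + i3)"

definition mon_odd :: "mon \<Rightarrow> bool" where
  "mon_odd I = (case exponents I of (i1, i2, i3) \<Rightarrow> odd (i1 + i2))"

definition word_of :: "mon \<Rightarrow> gen list" where
  "word_of I = (case exponents I of (i1, i2, i3) \<Rightarrow>
     replicate i1 W1 @ replicate i2 W2 @ replicate i3 W3)"

text \<open>The product in \<open>S(W)\<close> of the letters of a nonempty word, computed from
  \<open>uv = (-1)\<^sup>u\<^sup>v vu\<close>: it vanishes if an odd generator is repeated, and otherwise
  sorting the word costs a sign for each occurrence of \<open>w\<^sub>2\<close> to the left of \<open>w\<^sub>1\<close>.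
  (The empty word has no value in the reduced algebra and is never used.)\<close>

definition word_val :: "gen list \<Rightarrow> 'k::field SW" where
  "word_val v =
     (if v = [] \<or> count_list v W1 > 1 \<or> count_list v W2 > 1 then 0
      else Poly_Mapping.single (Mon (count_list v W1, count_list v W2, count_list v W3))
             ((- 1) ^ card {(i, j). i < j \<and> j < length v \<and> v ! i = W2 \<and> v ! j = W1}))"

text \<open>The product \<open>u \<cdot> v\<^sub>1 \<cdots> v\<^sub>r\<close> of \<open>u \<in> W\<close> with a possibly empty word.\<close>

definition mult_word :: "'k::field W \<Rightarrow> gen list \<Rightarrow> 'k SW" where
  "mult_word u v = lin_ext (\<lambda>j. word_val (j # v)) u"

text \<open>Positions are counted from \<open>0\<close>: \<open>unshuffles k n\<close> is \<open>Sh(k, n - k)\<close>.\<close>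

definition unshuffles :: "nat \<Rightarrow> nat \<Rightarrow> (nat \<Rightarrow> nat) set" where
  "unshuffles k n =
     {\<sigma>. \<sigma> permutes {..<n} \<and> strict_mono_on {..<k} \<sigma> \<and> strict_mono_on {k..<n} \<sigma>}"

text \<open>The sign in \<open>v\<^sub>\<sigma>\<^sub>(\<^sub>1\<^sub>) \<cdots> v\<^sub>\<sigma>\<^sub>(\<^sub>n\<^sub>) = \<epsilon>(\<sigma>) v\<^sub>1 \<cdots> v\<^sub>n\<close>: every pair of odd
  letters whose order is reversed contributes \<open>-1\<close>.\<close>

definition koszul :: "gen list \<Rightarrow> (nat \<Rightarrow> nat) \<Rightarrow> 'k::field" where
  "koszul v \<sigma> = (- 1) ^ card {(i, j). i < j \<and> j < length v \<and> \<sigma> j < \<sigma> i \<and>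
                                gen_odd (v ! \<sigma> i) \<and> gen_odd (v ! \<sigma> j)}"

definition letters :: "gen list \<Rightarrow> (nat \<Rightarrow> nat) \<Rightarrow> nat \<Rightarrow> nat \<Rightarrow> gen list" where
  "letters v \<sigma> a b = map (\<lambda>i. v ! \<sigma> i) [a..<b]"

definition comult :: "'k::field SW \<Rightarrow> (mon \<times> mon \<Rightarrow>\<^sub>0 'k)" where
  "comult = lin_ext (\<lambda>I. let v = word_of I; n = length v in
     \<Sum>k = 1..n - 1. \<Sum>\<sigma>\<in>unshuffles k n.
       scl (koszul v \<sigma>) (tensor (word_val (letters v \<sigma> 0 k)) (word_val (letters v \<sigma> k n))))"

section \<open>Cochains, coderivations and codifferentials\<close>

definition L :: "('k::field SW \<Rightarrow> 'k W) set" where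
  "L = {\<phi>. lin \<phi>}"

definition L_deg :: "nat \<Rightarrow> ('k::field SW \<Rightarrow> 'k W) set" where
  "L_deg n = {\<phi> \<in> L. \<forall>I. mon_size I \<noteq> n \<longrightarrow> \<phi> (Poly_Mapping.single I 1) = 0}"

text \<open>The component in \<open>L\<^sub>n\<close> of an element of \<open>L = \<Prod>\<^sub>n L\<^sub>n\<close>.\<close>

definition component :: "nat \<Rightarrow> ('k::field SW \<Rightarrow> 'k W) \<Rightarrow> 'k SW \<Rightarrow> 'k W" where
  "component n \<phi> = lin_ext (\<lambda>I. if mon_size I = n then \<phi> (Poly_Mapping.single I 1) else 0)"

text \<open>The coderivation \<open>\<phi>\<^sup>~\<close>; the sum over \<open>k\<close> runs over the components of \<open>\<phi>\<close>.\<close>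

definition coder :: "('k::field SW \<Rightarrow> 'k W) \<Rightarrow> 'k SW \<Rightarrow> 'k SW" where
  "coder \<phi> = lin_ext (\<lambda>I. let v = word_of I; n = length v in
     \<Sum>k = 1..n. \<Sum>\<sigma>\<in>unshuffles k n.
       scl (koszul v \<sigma>) (mult_word (\<phi> (word_val (letters v \<sigma> 0 k))) (letters v \<sigma> k n)))"

definition cochain_odd :: "('k::field SW \<Rightarrow> 'k W) \<Rightarrow> bool" where
  "cochain_odd \<phi> \<longleftrightarrow> odd_map mon_odd gen_odd \<phi>"

text \<open>The bracket of homogeneous elements (inhomogeneous ones do not occur below).\<close>

definition bracket ::
  "('k::field SW \<Rightarrow> 'k W) \<Rightarrow> ('k SW \<Rightarrow> 'k W) \<Rightarrow> 'k SW \<Rightarrow> 'k W" where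
  "bracket \<alpha> \<beta> = (\<lambda>x. \<alpha> (coder \<beta> x)
      - scl (if cochain_odd \<alpha> \<and> cochain_odd \<beta> then - 1 else 1) (\<beta> (coder \<alpha> x)))"

definition codifferential :: "('k::field SW \<Rightarrow> 'k W) \<Rightarrow> bool" where
  "codifferential d \<longleftrightarrow> d \<in> L \<and> cochain_odd d \<and> bracket d d = (\<lambda>x. 0)"

definition coalgebra_automorphism :: "('k::field SW \<Rightarrow> 'k SW) \<Rightarrow> bool" where
  "coalgebra_automorphism g \<longleftrightarrow> lin g \<and> bij g \<and> even_map mon_odd mon_odd g \<and>
     (\<forall>x. comult (g x) = tensor_map g g (comult x))"

definition equivalent :: "('k::field SW \<Rightarrow> 'k W) \<Rightarrow> ('k SW \<Rightarrow> 'k W) \<Rightarrow> bool" where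
  "equivalent d d' \<longleftrightarrow>
     (\<exists>g. coalgebra_automorphism g \<and> coder d' = inv g \<circ> coder d \<circ> g)"

definition is_extension ::
  "nat \<Rightarrow> ('k::field SW \<Rightarrow> 'k W) \<Rightarrow> ('k SW \<Rightarrow> 'k W) \<Rightarrow> bool" where
  "is_extension N dN d \<longleftrightarrow> dN \<in> L_deg N \<and> codifferential dN \<and> codifferential d \<and>
     (\<forall>k<N. component k d = (\<lambda>x. 0)) \<and> component N d = dN"

text \<open>\<open>phi i\<^sub>1 i\<^sub>2 i\<^sub>3 j\<close> is the element \<open>\<phi>\<^sup>I\<^sub>j\<close> with \<open>\<phi>\<^sup>I\<^sub>j(w\<^sub>J) = I! \<delta>\<^sup>I\<^sub>J w\<^sub>j\<close>
  (written \<open>\<psi>\<^sup>I\<^sub>j\<close> when odd), for \<open>i\<^sub>1, i\<^sub>2 \<le> 1\<close> and \<open>i\<^sub>1 + i\<^sub>2 + i\<^sub>3 \<ge> 1\<close>.\<close>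

definition phi :: "nat \<Rightarrow> nat \<Rightarrow> nat \<Rightarrow> gen \<Rightarrow> 'k::field SW \<Rightarrow> 'k W" where
  "phi i1 i2 i3 j = lin_ext (\<lambda>J.
     if exponents J = (i1, i2, i3)
     then Poly_Mapping.single j (of_nat (fact i1 * fact i2 * fact i3)) else 0)"

definition d_lam :: "nat \<Rightarrow> 'k::field \<Rightarrow> 'k SW \<Rightarrow> 'k W" where
  "d_lam m l = (\<lambda>x. phi 0 1 (m + 1) W3 x + scl l (phi 1 1 m W1 x))"

definition d_lam_e :: "nat \<Rightarrow> nat \<Rightarrow> 'k::field SW \<Rightarrow> 'k W" where
  "d_lam_e m n = (\<lambda>x. phi 0 1 (m + 1) W3 x - scl (of_nat n + 2) (phi 1 1 m W1 x)
                      + phi 0 0 (n + 2) W1 x)"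

end

(* Dually, a linear map from S(W) to W is a formal vector field on the superspace with even
   coordinate x and odd coordinates t1, t2, and codifferentials are the odd vector fields Q with
   Q^2 = 0.  Let Q be an extension of d_lambda.  After dividing by x^(m+1), Q x = x^(m+1) t2' for a
   new odd coordinate t2', and then Q^2 = 0 forces Q t2' = 0.  Rescaling t1 by a solution of
   a linear differential equation brings its image into the form
   Q t1' = e(x) + lambda x^m t1' t2', and now Q^2 = 0 says x e'(x) = - lambda e(x).
   So e vanishes, or lambda = - k and e is a multiple of x^k, with k = n + 2 > m + 2.
   The two cases are inequivalent since a coordinate change preserves the ideal (t1, t2), and
   d_lambda maps everything into this ideal, while d_(lambda,e) does not. *)

theory Submission
  imports Defs "HOL-Computational_Algebra.Formal_Power_Series" "HOL-Library.Product_Plus"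
begin

text \<open>The obstacle is the signs: the Koszul signs of unshuffles would burden every computation
  with \<open>coder\<close> and \<open>comult\<close>. They are dealt with once. A function without
  constant term is the same thing as a linear functional on S(W), a word acting on it by iterated
  left derivatives. The graded Leibniz rule then turns \<open>comult\<close> into the product of
  functions and \<open>coder\<close> into a vector field, and the rest is algebra with four power
  series in x.

  The coordinate changes that reach the normal form fix x, so they are triangular matrices over the
  power series in x. Their transposes under the pairing are the required automorphisms, and the
  components g_i never have to be written down.

  For non-equivalence the automorphism g is arbitrary. The span of the powers of w3 is what the
  ideal (t1, t2) annihilates. Only the inclusion of its image under g in itself is shown, and a
  dimension count makes this enough: g would embed the span of w3, ..., w3^(n+2) into that of w3,
  ..., w3^(n+1).\<close>

abbreviation lookup :: "('b \<Rightarrow>\<^sub>0 'k::zero) \<Rightarrow> 'b \<Rightarrow> 'k" where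
  "lookup \<equiv> Poly_Mapping.lookup"

abbreviation keys :: "('b \<Rightarrow>\<^sub>0 'k::zero) \<Rightarrow> 'b set" where
  "keys \<equiv> Poly_Mapping.keys"

section \<open>Linear maps between free vector spaces\<close>

lemma lookup_scl [simp]: "lookup (scl c x) b = c * lookup x b"
  by (simp add: scl_def Poly_Mapping.map.rep_eq when_def)

lemma vector_space_scl: "vector_space (scl :: 'k::field \<Rightarrow> ('b \<Rightarrow>\<^sub>0 'k) \<Rightarrow> _)"
  by unfold_locales (auto intro!: poly_mapping_eqI simp: lookup_add algebra_simps)

lemma lin_iff: "lin f \<longleftrightarrow> (\<forall>x y. f (x + y) = f x + f y) \<and> (\<forall>c x. f (scl c x) = scl c (f x))"
  by (auto simp: Vector_Spaces.linear_def module_hom_def module_hom_axioms_def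
      module_iff_vector_space vector_space_scl)

text \<open>Here \<open>w\<close> runs through all functions on the basis, that is, through the full
  dual of the free space. Vectors are compared below by testing them against functionals, which
  commute with sums, scalars and \<open>lin_ext\<close> by simplification.\<close>

definition pairing :: "('b \<Rightarrow> 'k) \<Rightarrow> ('b \<Rightarrow>\<^sub>0 'k::field) \<Rightarrow> 'k" where
  "pairing w x = (\<Sum>b\<in>keys x. lookup x b * w b)"

lemma pairing_superset:
  assumes "finite A" "keys x \<subseteq> A"
  shows "pairing w x = (\<Sum>b\<in>A. lookup x b * w b)"
  unfolding pairing_def
  by (rule sum.mono_neutral_left) (use assms in \<open>auto simp: in_keys_iff\<close>)

lemma pairing_add [simp]: "pairing w (x + y) = pairing w x + pairing w y"
proof -
  let ?A = "keys x \<union> keys y"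
  have "keys (x + y) \<subseteq> ?A" by (rule Poly_Mapping.keys_add)
  then show ?thesis
    by (simp add: pairing_superset[of ?A] lookup_add sum.distrib algebra_simps)
qed

lemma pairing_scl [simp]: "pairing w (scl c x) = c * pairing w x"
  by (subst pairing_superset[of "keys x"])
     (auto simp: in_keys_iff pairing_def sum_distrib_left mult.assoc)

lemma pairing_zero [simp]: "pairing w 0 = 0"
  by (simp add: pairing_def)

lemma pairing_sum [simp]: "pairing w (\<Sum>i\<in>A. h i) = (\<Sum>i\<in>A. pairing w (h i))"
  by (induction A rule: infinite_finite_induct) auto

lemma pairing_single [simp]: "pairing w (Poly_Mapping.single b c) = c * w b"
  by (simp add: pairing_def)

lemma pairing_delta: "pairing (\<lambda>c. if c = b then 1 else 0) x = lookup x b"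
  by (simp add: pairing_def if_distrib in_keys_iff cong: if_cong)

lemma pairing_delta_times: "pairing (\<lambda>c. if c = b then u else 0) x = lookup x b * u"
  by (simp add: pairing_def if_distrib in_keys_iff cong: if_cong)

lemma pairing_const_zero [simp]: "pairing (\<lambda>b. 0) x = 0"
  by (simp add: pairing_def)

lemma pairing_eqI: "(\<And>w. pairing w x = pairing w y) \<Longrightarrow> x = y"
  by (metis pairing_delta poly_mapping_eqI)

lemma pairing_lin_ext [simp]: "pairing w (lin_ext f x) = pairing (\<lambda>b. pairing w (f b)) x"
  by (simp add: lin_ext_def pairing_def[of _ x])

lemma lin_lin_ext: "lin (lin_ext f)"
  unfolding lin_iff by (auto intro!: pairing_eqI)

lemma lin_ext_single [simp]: "lin_ext f (Poly_Mapping.single b c) = scl c (f b)"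
  by (rule pairing_eqI) simp

lemma lookup_lin_ext: "lookup (lin_ext f x) c = pairing (\<lambda>b. lookup (f b) c) x"
  by (simp flip: pairing_delta)

lemma lin_eq_lin_ext:
  fixes f :: "('b \<Rightarrow>\<^sub>0 'k::field) \<Rightarrow> ('c \<Rightarrow>\<^sub>0 'k)"
  assumes "lin f"
  shows "f x = lin_ext (\<lambda>b. f (Poly_Mapping.single b 1)) x"
proof -
  have add: "f (x + y) = f x + f y" and scl: "f (scl c x) = scl c (f x)" for x y c
    using assms by (auto simp: lin_iff)
  have [simp]: "f 0 = 0"
    using add[of 0 0] by simp
  have sum: "f (\<Sum>i\<in>A. h i) = (\<Sum>i\<in>A. f (h i))" for A :: "'b set" and h
    by (induction A rule: infinite_finite_induct) (auto simp: add)
  have "x = (\<Sum>b\<in>keys x. scl (lookup x b) (Poly_Mapping.single b 1))"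
    by (rule pairing_eqI) (simp add: pairing_def[of _ x])
  then have "f x = f (\<Sum>b\<in>keys x. scl (lookup x b) (Poly_Mapping.single b 1))"
    by (rule arg_cong)
  also have "\<dots> = (\<Sum>b\<in>keys x. scl (lookup x b) (f (Poly_Mapping.single b 1)))"
    by (simp add: sum scl)
  finally have "f x = (\<Sum>b\<in>keys x. scl (lookup x b) (f (Poly_Mapping.single b 1)))" .
  then show ?thesis
    by (simp add: lin_ext_def)
qed

lemma pairing_lin:
  assumes "lin f"
  shows "pairing w (f x) = pairing (\<lambda>b. pairing w (f (Poly_Mapping.single b 1))) x"
  by (subst lin_eq_lin_ext[OF assms]) simp

lemma pairing_tensor:
  "pairing (\<lambda>(a, b). w a * w' b) (tensor x y) = pairing w x * pairing w' y"
  by (simp add: tensor_def pairing_def[of _ x] pairing_def[of _ y] sum_product algebra_simps)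

lemma pairing_tensor_map:
  "pairing (\<lambda>(a, b). w a * w' b) (tensor_map f g t) =
   pairing (\<lambda>(a, b). pairing w (f (Poly_Mapping.single a 1)) *
                     pairing w' (g (Poly_Mapping.single b 1))) t"
  by (simp add: tensor_map_def case_prod_unfold pairing_tensor[unfolded case_prod_unfold])

text \<open>Each coordinate functional of the tensor product is a product of two delta functionals,
  so product functionals separate its vectors.\<close>

lemma pairing_prod_eqI:
  fixes s t :: "'a \<times> 'b \<Rightarrow>\<^sub>0 'c::field"
  assumes "\<And>w w'. pairing (\<lambda>(a, b). w a * w' b) s = pairing (\<lambda>(a, b). w a * w' b) t"
  shows "s = t"
proof (rule poly_mapping_eqI)
  fix p :: "'a \<times> 'b"
  obtain i j where p: "p = (i, j)" by force
  have "(\<lambda>(a, b). (if a = i then 1 else 0) * (if b = j then 1 else 0)) =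
        (\<lambda>c. if c = p then 1 else (0 :: 'c))"
    by (auto simp: p)
  then show "lookup s p = lookup t p"
    using assms[of "\<lambda>a. if a = i then 1 else 0" "\<lambda>b. if b = j then 1 else 0"]
    by (simp add: pairing_delta)
qed

section \<open>Sums over unshuffles\<close>

text \<open>A permutation in \<^term>\<open>unshuffles k n\<close> is determined by the set \<open>S\<close> of the first
  \<open>k\<close> positions; the pairs in \<open>cross v S\<close> are those that contribute to its Koszul sign.\<close>

definition cross :: "gen list \<Rightarrow> nat set \<Rightarrow> (nat \<times> nat) set" where
  "cross v S = {(a, b). a < b \<and> b < length v \<and> a \<notin> S \<and> b \<in> S \<and>
                  gen_odd (v ! a) \<and> gen_odd (v ! b)}"

abbreviation odd_count :: "gen list \<Rightarrow> nat" where
  "odd_count v \<equiv> length (filter gen_odd v)"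

lemma nths_eq_map:
  assumes "S \<subseteq> {..<length v}"
  shows "nths v S = map ((!) v) (sorted_list_of_set S)"
proof -
  have "sorted_list_of_set S = filter (\<lambda>i. i \<in> S) [0..<length v]"
    by (rule sorted_distinct_set_unique) (use assms finite_subset[OF assms] in \<open>auto simp: sorted_wrt_filter\<close>)
  moreover have "zip v [0..<length v] = map (\<lambda>i. (v ! i, i)) [0..<length v]"
    by (rule nth_equalityI) auto
  ultimately show ?thesis
    by (simp add: nths_def filter_map comp_def)
qed

lemma map_strict_mono_on_eq:
  assumes "strict_mono_on {a..<b} \<sigma>"
  shows "map \<sigma> [a..<b] = sorted_list_of_set (\<sigma> ` {a..<b :: nat} :: nat set)"
proof (rule sym, rule strict_sorted_equal)
  show "sorted_wrt (<) (map \<sigma> [a..<b])"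
    using assms by (auto simp: sorted_wrt_map strict_mono_on_def
        intro!: sorted_wrt_mono_rel[OF _ sorted_wrt_upt])
qed auto

text \<open>Monotonicity on both blocks forces the permutation to list the image of the first block
  in increasing order and then the complement in increasing order. Conversely, every set of
  positions gives such a list.\<close>

lemma bij_betw_unshuffles:
  assumes "k \<le> n"
  shows "bij_betw (\<lambda>\<sigma>. \<sigma> ` {..<k}) (unshuffles k n) {S. S \<subseteq> {..<n} \<and> card S = k}"
proof (rule bij_betwI')
  fix \<sigma> \<tau>
  assume \<sigma>: "\<sigma> \<in> unshuffles k n" and \<tau>: "\<tau> \<in> unshuffles k n"
  show "\<sigma> ` {..<k} = \<tau> ` {..<k} \<longleftrightarrow> \<sigma> = \<tau>"
  proof
    assume eq: "\<sigma> ` {..<k} = \<tau> ` {..<k}"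
    have img: "\<rho> ` {k..<n} = {..<n} - \<rho> ` {..<k}" if "\<rho> \<in> unshuffles k n" for \<rho>
    proof -
      have "\<rho> permutes {..<n}" using that by (simp add: unshuffles_def)
      then show ?thesis
        using image_set_diff[OF permutes_inj, of \<rho> "{..<n}" "{..<n}" "{..<k}"]
        by (simp add: permutes_image lessThan_minus_lessThan)
    qed
    have "map \<sigma> [0..<k] = map \<tau> [0..<k]"
      using \<sigma> \<tau> eq by (simp add: map_strict_mono_on_eq unshuffles_def atLeast0LessThan)
    moreover have "map \<sigma> [k..<n] = map \<tau> [k..<n]"
      using \<sigma> \<tau> eq img[OF \<sigma>] img[OF \<tau>] by (simp add: map_strict_mono_on_eq unshuffles_def)
    ultimately have "\<sigma> i = \<tau> i" if "i < n" for i
      using that by (cases "i < k") auto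
    moreover have "\<sigma> i = \<tau> i" if "\<not> i < n" for i
      using that \<sigma> \<tau> by (auto simp: unshuffles_def permutes_def)
    ultimately show "\<sigma> = \<tau>" by blast
  qed simp
next
  fix \<sigma> assume "\<sigma> \<in> unshuffles k n"
  then have \<sigma>: "\<sigma> permutes {..<n}" by (simp add: unshuffles_def)
  have "\<sigma> ` {..<k} \<subseteq> \<sigma> ` {..<n}" using assms by auto
  then show "\<sigma> ` {..<k} \<in> {S. S \<subseteq> {..<n} \<and> card S = k}"
    using \<sigma> by (auto simp: permutes_image card_image permutes_inj_on)
next
  fix S assume "S \<in> {S. S \<subseteq> {..<n} \<and> card S = k}"
  then have S: "S \<subseteq> {..<n}" "card S = k" by auto
  then have fin: "finite S" by (auto intro: finite_subset)
  define l where "l = sorted_list_of_set S @ sorted_list_of_set ({..<n} - S)"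
  define \<sigma> where "\<sigma> i = (if i < n then l ! i else i)" for i
  have set_l: "set l = {..<n}" and dist: "distinct l" using S fin by (auto simp: l_def)
  then have len: "length l = n" using distinct_card[OF dist] by simp
  have "bij_betw ((!) l) {..<n} {..<n}"
    using len set_l by (intro bij_betw_nth[OF dist]) auto
  moreover have "bij_betw \<sigma> {..<n} {..<n} = bij_betw ((!) l) {..<n} {..<n}"
    by (rule bij_betw_cong) (simp add: \<sigma>_def)
  ultimately have "bij_betw \<sigma> {..<n} {..<n}"
    by simp
  then have "\<sigma> permutes {..<n}"
    by (rule bij_imp_permutes) (simp add: \<sigma>_def)
  moreover have lo: "\<sigma> i = sorted_list_of_set S ! i" if "i < k" for i
    using that assms S by (simp add: \<sigma>_def l_def nth_append)
  moreover have hi: "\<sigma> i = sorted_list_of_set ({..<n} - S) ! (i - k)" if "k \<le> i" "i < n" for i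
    using that S by (simp add: \<sigma>_def l_def nth_append)
  moreover have "strict_mono_on {..<k} \<sigma>"
    using S by (auto simp: strict_mono_on_def lo intro!: sorted_wrt_nth_less[OF strict_sorted_list_of_set])
  moreover have "strict_mono_on {k..<n} \<sigma>"
    using S fin
    by (auto simp: strict_mono_on_def hi card_Diff_subset intro!: sorted_wrt_nth_less[OF strict_sorted_list_of_set])
  ultimately have "\<sigma> \<in> unshuffles k n" by (simp add: unshuffles_def)
  moreover have "S = \<sigma> ` {..<k}"
  proof -
    have "\<sigma> ` {..<k} = (!) (sorted_list_of_set S) ` {..<length (sorted_list_of_set S)}"
      using lo S by auto
    also have "\<dots> = set (sorted_list_of_set S)"
      by (auto simp: in_set_conv_nth simp del: set_sorted_list_of_set)
    finally show ?thesis using fin by simp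
  qed
  ultimately show "\<exists>\<sigma>\<in>unshuffles k n. S = \<sigma> ` {..<k}" by blast
qed

lemma unshuffle_letters:
  assumes "\<sigma> \<in> unshuffles k n" "k \<le> n" "length v = n"
  shows "letters v \<sigma> 0 k = nths v (\<sigma> ` {..<k})"
    and "letters v \<sigma> k n = nths v (- \<sigma> ` {..<k})"
proof -
  have perm: "\<sigma> permutes {..<n}" and mono: "strict_mono_on {0..<k} \<sigma>" "strict_mono_on {k..<n} \<sigma>"
    using assms by (auto simp: unshuffles_def atLeast0LessThan)
  have sub: "\<sigma> ` {..<k} \<subseteq> {..<n}" "\<sigma> ` {k..<n} \<subseteq> {..<n}"
    using permutes_image[OF perm] assms(2) by auto
  have "nths v (- \<sigma> ` {..<k}) = nths v (\<sigma> ` {k..<n})"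
  proof -
    have "\<sigma> ` {k..<n} = {..<n} - \<sigma> ` {..<k}"
      using image_set_diff[OF permutes_inj[OF perm], of "{..<n}" "{..<k}"]
      by (simp add: permutes_image[OF perm] lessThan_minus_lessThan)
    then show ?thesis
      using assms(3) unfolding nths_def
      by (auto intro!: arg_cong[where f = "map fst"] filter_cong dest!: set_zip_rightD)
  qed
  moreover have letters: "letters v \<sigma> a b = map ((!) v) (map \<sigma> [a..<b])" for a b
    by (simp add: letters_def)
  ultimately show "letters v \<sigma> 0 k = nths v (\<sigma> ` {..<k})"
    and "letters v \<sigma> k n = nths v (- \<sigma> ` {..<k})"
    using sub assms(3) map_strict_mono_on_eq[OF mono(1)] map_strict_mono_on_eq[OF mono(2)]
    by (simp_all only: letters nths_eq_map atLeast0LessThan)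
qed

text \<open>Since \<sigma> increases on each block, an inversion has i < k \<le> j. So (i, j)
  \<mapsto> (\<sigma> j, \<sigma> i) matches the inversions of odd letters with the pairs in
  \<open>cross\<close>.\<close>

lemma koszul_unshuffle:
  assumes "\<sigma> \<in> unshuffles k n" "k \<le> n" "length v = n"
  shows "koszul v \<sigma> = (- 1) ^ card (cross v (\<sigma> ` {..<k}))"
proof -
  have perm: "\<sigma> permutes {..<n}" and mono: "strict_mono_on {..<k} \<sigma>" "strict_mono_on {k..<n} \<sigma>"
    using assms by (auto simp: unshuffles_def)
  have inj: "\<sigma> i = \<sigma> j \<longleftrightarrow> i = j" for i j
    using permutes_inj[OF perm] by (auto simp: inj_def)
  have bd: "\<sigma> i < n \<longleftrightarrow> i < n" for i
    using permutes_in_image[OF perm, of i] by simp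
  have split: "i < k \<and> k \<le> j" if "i < j" "j < n" "\<sigma> j < \<sigma> i" for i j
    using that strict_mono_onD[OF mono(1), of i j] strict_mono_onD[OF mono(2), of i j]
    by (metis atLeastLessThan_iff lessThan_iff not_less_iff_gr_or_eq not_le less_trans less_le_trans)
  let ?I = "{(i, j). i < j \<and> j < length v \<and> \<sigma> j < \<sigma> i \<and> gen_odd (v ! \<sigma> i) \<and> gen_odd (v ! \<sigma> j)}"
  have "(\<lambda>(i, j). (\<sigma> j, \<sigma> i)) ` ?I = cross v (\<sigma> ` {..<k})"
  proof (intro equalityI subsetI)
    fix p assume "p \<in> (\<lambda>(i, j). (\<sigma> j, \<sigma> i)) ` ?I"
    then obtain i j where p: "p = (\<sigma> j, \<sigma> i)" and ij: "(i, j) \<in> ?I" by auto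
    then have "i < k" "k \<le> j" using split[of i j] assms(3) by auto
    then have "\<sigma> i \<in> \<sigma> ` {..<k}" "\<sigma> j \<notin> \<sigma> ` {..<k}" using inj by auto
    then show "p \<in> cross v (\<sigma> ` {..<k})"
      using ij assms(3) bd[of i] by (simp add: cross_def p)
  next
    fix p assume "p \<in> cross v (\<sigma> ` {..<k})"
    then obtain a i where p: "p = (a, \<sigma> i)" "i < k" "a < \<sigma> i" "\<sigma> i < n" "a \<notin> \<sigma> ` {..<k}"
      "gen_odd (v ! a)" "gen_odd (v ! \<sigma> i)"
      using assms(3) by (auto simp: cross_def)
    obtain j where j: "a = \<sigma> j"
      using permutes_surj[OF perm] by blast
    have "k \<le> j" "j < n" using p bd[of j] j by (auto intro: leI)
    then have "(i, j) \<in> ?I" using p j assms(3) by simp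
    then show "p \<in> (\<lambda>(i, j). (\<sigma> j, \<sigma> i)) ` ?I" using p j by (intro image_eqI[of _ _ "(i, j)"]) simp_all
  qed
  moreover have "inj_on (\<lambda>(i, j). (\<sigma> j, \<sigma> i)) ?I" by (rule inj_onI) (simp add: case_prod_unfold inj prod_eq_iff)
  then have "card ((\<lambda>(i, j). (\<sigma> j, \<sigma> i)) ` ?I) = card ?I" by (rule card_image)
  ultimately show ?thesis
    unfolding koszul_def by simp
qed

text \<open>The signed sum over unshuffles as a recursion on the word: the head goes either to the
  selected letters \<open>A\<close> or to the remaining letters \<open>B\<close>. In the second case
  all of \<open>A\<close> has to be moved to its left, which costs a sign for each odd letter of
  \<open>A\<close> if the head is odd.\<close>

primrec usum :: "gen list \<Rightarrow> ('k::comm_ring_1 \<Rightarrow> gen list \<Rightarrow> gen list \<Rightarrow> 'a::comm_monoid_add) \<Rightarrow> 'a" where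
  "usum [] F = F 1 [] []"
| "usum (x # v) F = usum v (\<lambda>s A B. F s (x # A) B) +
     usum v (\<lambda>s A B. F (if gen_odd x \<and> odd (odd_count A) then - s else s) A (x # B))"

lemma Pow_lessThan_Suc:
  "Pow {..<Suc n} = (\<lambda>T. insert 0 (Suc ` T)) ` Pow {..<n} \<union> (`) Suc ` Pow {..<n}"
proof -
  have "{..<Suc n} = insert 0 (Suc ` {..<n})" by (simp add: lessThan_Suc_eq_insert_0)
  then show ?thesis
    by (simp add: Pow_insert image_Pow_surj[symmetric] image_image Un_commute)
qed

lemma card_cross_insert_0:
  "card (cross (x # v) (insert 0 (Suc ` T))) = card (cross v T)"
proof -
  have "cross (x # v) (insert 0 (Suc ` T)) = map_prod Suc Suc ` cross v T"
    by (force simp: cross_def image_iff gr0_conv_Suc nth_Cons less_Suc_eq_0_disj split: nat.splits)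
  moreover have "inj_on (map_prod Suc Suc) (cross v T)"
    by (rule inj_on_subset[OF prod.inj_map]) auto
  ultimately show ?thesis
    by (simp add: card_image)
qed

text \<open>An omitted odd head is crossed by every selected odd letter; these are the pairs in
  \<open>?B\<close>.\<close>

lemma card_cross_Suc:
  assumes "T \<subseteq> {..<length v}"
  shows "card (cross (x # v) (Suc ` T)) =
    card (cross v T) + (if gen_odd x then odd_count (nths v T) else 0)"
proof -
  let ?B = "if gen_odd x then (\<lambda>b. (0 :: nat, Suc b)) ` {b \<in> T. gen_odd (v ! b)} else {}"
  have fin: "finite T" using assms finite_subset by blast
  have "cross (x # v) (Suc ` T) = map_prod Suc Suc ` cross v T \<union> ?B"
    using assms by (force simp: cross_def image_iff gr0_conv_Suc nth_Cons less_Suc_eq_0_disj split: nat.splits)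
  moreover have inj: "inj_on (map_prod Suc Suc) (cross v T)"
    by (rule inj_on_subset[OF prod.inj_map]) auto
  moreover have "finite (cross v T)"
    by (rule finite_subset[of _ "{..<length v} \<times> {..<length v}"]) (auto simp: cross_def)
  moreover have "map_prod Suc Suc ` cross v T \<inter> ?B = {}" by auto
  moreover have "card ?B = (if gen_odd x then odd_count (nths v T) else 0)"
  proof -
    have "card ((\<lambda>b. (0 :: nat, Suc b)) ` {b \<in> T. gen_odd (v ! b)}) = card {b \<in> T. gen_odd (v ! b)}"
      by (rule card_image) (auto simp: inj_on_def)
    also have "card {b \<in> T. gen_odd (v ! b)} = card ( {b. gen_odd (v ! b)} \<inter> set (sorted_list_of_set T))"
      using fin by (intro arg_cong[where f = card]) auto
    also have "\<dots> = odd_count (nths v T)"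
      unfolding nths_eq_map[OF assms]
      by (subst distinct_length_filter[symmetric]) (auto simp: filter_map comp_def)
    finally show ?thesis by simp
  qed
  ultimately show ?thesis
    using fin inj by (simp add: card_Un_disjoint card_image)
qed

lemma usum_eq_sum_Pow:
  "usum v F = (\<Sum>S\<in>Pow {..<length v}. F ((- 1) ^ card (cross v S)) (nths v S) (nths v (- S)))"
proof (induction v arbitrary: F)
  case Nil
  have "cross [] {} = {}" by (auto simp: cross_def)
  then show ?case by simp
next
  case (Cons x v)
  let ?P = "Pow {..<length v}"
  let ?t = "\<lambda>S. F ((- 1) ^ card (cross (x # v) S)) (nths (x # v) S) (nths (x # v) (- S))"
  have sets: "{j. Suc j \<in> insert 0 (Suc ` T)} = T" "{j. Suc j \<notin> Suc ` T} = - T"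
    "{j. Suc j \<in> Suc ` T} = T" "{j. Suc j \<in> - Suc ` T} = - T" for T
    by auto
  have "(\<Sum>S\<in>Pow {..<length (x # v)}. ?t S) =
      (\<Sum>T\<in>?P. ?t (insert 0 (Suc ` T))) + (\<Sum>T\<in>?P. ?t (Suc ` T))"
  proof -
    have "inj_on (\<lambda>T. insert 0 (Suc ` T)) ?P"
      by (rule inj_onI) (metis (no_types, lifting) Diff_insert_absorb image_iff inj_Suc inj_image_eq_iff nat.distinct(1))
    moreover have "inj_on ((`) Suc) ?P"
      by (rule inj_onI) (simp add: inj_image_eq_iff)
    ultimately show ?thesis
      by (simp only: length_Cons Pow_lessThan_Suc)
         (subst sum.union_disjoint, auto simp: sum.reindex)
  qed
  also have "(\<Sum>T\<in>?P. ?t (insert 0 (Suc ` T))) = usum v (\<lambda>s A B. F s (x # A) B)"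
    by (simp add: Cons.IH card_cross_insert_0 nths_Cons sets)
  also have "(\<Sum>T\<in>?P. ?t (Suc ` T)) =
      usum v (\<lambda>s A B. F (if gen_odd x \<and> odd (odd_count A) then - s else s) A (x # B))"
    unfolding Cons.IH
    by (rule sum.cong) (auto simp: card_cross_Suc nths_Cons sets power_add)
  finally show ?case by simp
qed

text \<open>Position sets are grouped by their size. The sum starts at k = 0, unlike those in
  \<open>comult\<close> and \<open>coder\<close>; wherever this is applied, the summands added at
  the ends vanish because a constant term does.\<close>

lemma sum_unshuffles_eq_usum:
  assumes "length v = n"
  shows "(\<Sum>k\<le>n. \<Sum>\<sigma>\<in>unshuffles k n. F (koszul v \<sigma>) (letters v \<sigma> 0 k) (letters v \<sigma> k n)) = usum v F"
proof -
  let ?t = "\<lambda>S. F ((- 1) ^ card (cross v S)) (nths v S) (nths v (- S))"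
  have "(\<Sum>k\<le>n. \<Sum>\<sigma>\<in>unshuffles k n. F (koszul v \<sigma>) (letters v \<sigma> 0 k) (letters v \<sigma> k n)) =
      (\<Sum>k\<le>n. \<Sum>\<sigma>\<in>unshuffles k n. ?t (\<sigma> ` {..<k}))"
    using assms by (simp add: koszul_unshuffle unshuffle_letters)
  also have "\<dots> = (\<Sum>k\<le>n. \<Sum>S\<in>{S \<in> Pow {..<n}. card S = k}. ?t S)"
    by (intro sum.cong refl) (simp add: sum.reindex_bij_betw[OF bij_betw_unshuffles, symmetric])
  also have "\<dots> = (\<Sum>S\<in>Pow {..<n}. ?t S)"
    by (rule sum.group) (auto simp: card_mono[of "{..<n}", simplified])
  finally show ?thesis using assms by (simp add: usum_eq_sum_Pow)
qed

section \<open>Functions on \<open>W\<close> and duality\<close>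

text \<open>The tuple \<open>(a, b, c, d)\<close> stands for \<open>a + b t\<^sub>1 + c t\<^sub>2 + d t\<^sub>1 t\<^sub>2\<close>, where the odd
  coordinates \<open>t\<^sub>1, t\<^sub>2\<close> are dual to \<open>w\<^sub>1, w\<^sub>2\<close>.\<close>

type_synonym 'k sf = "'k fps \<times> 'k fps \<times> 'k fps \<times> 'k fps"

fun sf_mult :: "'k::comm_ring_1 sf \<Rightarrow> 'k sf \<Rightarrow> 'k sf" (infixl "\<odot>" 70) where
  "(a, b, c, d) \<odot> (a', b', c', d') =
     (a * a', a * b' + b * a', a * c' + c * a', a * d' + d * a' + b * c' - c * b')"

text \<open>The odd derivatives act from the left; the minus sign comes from moving the derivative
  by t2 past t1.\<close>

fun sf_deriv :: "gen \<Rightarrow> 'k::comm_ring_1 sf \<Rightarrow> 'k sf" where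
  "sf_deriv W1 (a, b, c, d) = (b, 0, d, 0)"
| "sf_deriv W2 (a, b, c, d) = (c, - d, 0, 0)"
| "sf_deriv W3 (a, b, c, d) = (fps_deriv a, fps_deriv b, fps_deriv c, fps_deriv d)"

text \<open>The parity automorphism: it supplies the sign in the graded Leibniz rule for an odd
  derivative.\<close>

fun sf_bar :: "'k::comm_ring_1 sf \<Rightarrow> 'k sf" where
  "sf_bar (a, b, c, d) = (a, - b, - c, d)"

fun sf_coeff :: "'k::comm_ring_1 sf \<Rightarrow> nat \<times> nat \<times> nat \<Rightarrow> 'k" where
  "sf_coeff (a, b, c, d) (i, j, k) =
     fps_nth (if i = 0 then if j = 0 then a else c else if j = 0 then b else d) k"

text \<open>The pairing of a function with a word differentiates it along the letters, so that
  the Koszul signs of unshuffles come out of the graded Leibniz rule.\<close>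

primrec ev :: "gen list \<Rightarrow> 'k::comm_ring_1 sf \<Rightarrow> 'k" where
  "ev [] f = sf_coeff f (0, 0, 0)"
| "ev (j # v) f = ev v (sf_deriv j f)"

lemma sf_deriv_add: "sf_deriv j (f + g) = sf_deriv j f + sf_deriv j g"
  by (cases j; cases f; cases g) auto

lemma sf_deriv_uminus: "sf_deriv j (- f) = - sf_deriv j f"
  by (cases j; cases f) auto

lemma sf_deriv_mult:
  "sf_deriv j (f \<odot> g) = sf_deriv j f \<odot> g + (if gen_odd j then sf_bar f else f) \<odot> sf_deriv j g"
  by (cases j; cases f; cases g) (auto simp: algebra_simps)

lemma sf_deriv_bar:
  "sf_deriv j (sf_bar f) = (if gen_odd j then - sf_bar (sf_deriv j f) else sf_bar (sf_deriv j f))"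
  by (cases j; cases f) auto

lemma ev_add [simp]: "ev v (f + g) = ev v f + ev v g"
  by (induction v arbitrary: f g) (auto simp: sf_deriv_add)

lemma ev_uminus [simp]: "ev v (- f) = - ev v f"
  by (induction v arbitrary: f) (auto simp: sf_deriv_uminus)

lemma ev_zero [simp]: "ev v 0 = 0"
  by (metis add_cancel_right_right add_0 ev_add)

lemma ev_sum [simp]: "ev v (\<Sum>i\<in>A. f i) = (\<Sum>i\<in>A. ev v (f i))"
  by (induction A rule: infinite_finite_induct) auto

lemma ev_bar: "ev v (sf_bar f) = (- 1) ^ odd_count v * ev v f"
  by (induction v arbitrary: f) (auto simp: sf_deriv_bar)

text \<open>This is the iterated graded Leibniz rule. The derivative along the head hits
  \<open>f\<close> (head selected) or \<open>g\<close> (head omitted). In the second case an odd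
  head leaves \<open>sf_bar f\<close> behind, and pairing that with \<open>A\<close> gives exactly
  the sign built into \<open>usum\<close>.\<close>

lemma usum_ev_mult: "usum v (\<lambda>s A B. s * ev A f * ev B g) = ev v (f \<odot> g)"
proof (induction v arbitrary: f g)
  case Nil
  show ?case by (cases f; cases g) simp
next
  case (Cons x v)
  have "(if gen_odd x \<and> odd (odd_count A) then - s else s) * ev A f * ev B (sf_deriv x g) =
    s * ev A (if gen_odd x then sf_bar f else f) * ev B (sf_deriv x g)" for s A B
    by (auto simp: ev_bar)
  then show ?case
    by (simp add: Cons.IH sf_deriv_mult)
qed

section \<open>Words as functionals: the pairing between S(W) and functions\<close>

definition inversions :: "gen list \<Rightarrow> nat" where
  "inversions v = card {(i, j). i < j \<and> j < length v \<and> v ! i = W2 \<and> v ! j = W1}"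

lemma inversions_Nil [simp]: "inversions [] = 0"
  by (simp add: inversions_def)

lemma inversions_Cons [simp]:
  "inversions (x # v) = inversions v + (if x = W2 then count_list v W1 else 0)"
proof -
  let ?I = "{(i, j). i < j \<and> j < length v \<and> v ! i = W2 \<and> v ! j = W1}"
  let ?B = "if x = W2 then (\<lambda>b. (0 :: nat, Suc b)) ` {b. b < length v \<and> v ! b = W1} else {}"
  have "{(i, j). i < j \<and> j < length (x # v) \<and> (x # v) ! i = W2 \<and> (x # v) ! j = W1} =
      map_prod Suc Suc ` ?I \<union> ?B"
    by (force simp: image_iff gr0_conv_Suc nth_Cons less_Suc_eq_0_disj split: nat.splits)
  moreover have "finite ?I"
    by (rule finite_subset[of _ "{..<length v} \<times> {..<length v}"]) auto
  moreover have "map_prod Suc Suc ` ?I \<inter> ?B = {}" by auto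
  moreover have "inj_on (map_prod Suc Suc) ?I"
    by (rule inj_on_subset[OF prod.inj_map]) auto
  moreover have "card ?B = (if x = W2 then count_list v W1 else 0)"
  proof -
    have "card ((\<lambda>b. (0 :: nat, Suc b)) ` {b. b < length v \<and> v ! b = W1}) =
        card {b. b < length v \<and> v ! b = W1}"
      by (rule card_image) (auto simp: inj_on_def)
    then show ?thesis
      by (simp add: count_list_eq_length_filter length_filter_conv_card eq_commute)
  qed
  ultimately show ?thesis
    by (simp add: inversions_def card_Un_disjoint card_image)
qed

text \<open>Odd derivatives square to zero and anticommute, just as odd letters do. Thus a word
  differentiates a function with the same vanishing and the same sign as in \<open>word_val\<close>,
  while k letters w3 produce k! times a coefficient.\<close>

lemma ev_eq_coeff:
  fixes f :: "'k::field_char_0 sf"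
  shows "ev v f = (if count_list v W1 > 1 \<or> count_list v W2 > 1 then 0
     else (- 1) ^ inversions v * fact (count_list v W3) *
          sf_coeff f (count_list v W1, count_list v W2, count_list v W3))"
proof (induction v arbitrary: f)
  case (Cons x v)
  obtain a b c d where f: "f = (a, b, c, d)" by (cases f) auto
  consider "count_list v W1 = 0" | "count_list v W1 = 1" | "count_list v W1 > 1" by linarith
  then show ?case
  proof cases
    case 1
    then show ?thesis
      by (cases x) (auto simp: Cons.IH f algebra_simps)
  next
    case 2
    then show ?thesis
      by (cases x) (auto simp: Cons.IH f algebra_simps)
  next
    case 3
    then show ?thesis
      by (cases x) (auto simp: Cons.IH f)
  qed
qed simp

lemma exponents_Mon:
  "i \<le> 1 \<Longrightarrow> j \<le> 1 \<Longrightarrow> i + j + k \<ge> 1 \<Longrightarrow> exponents (Mon (i, j, k)) = (i, j, k)"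
  by (rule Mon_inverse) simp

lemma Mon_eq_iff:
  "i \<le> 1 \<Longrightarrow> j \<le> 1 \<Longrightarrow> i + j + k \<ge> 1 \<Longrightarrow> i' \<le> 1 \<Longrightarrow> j' \<le> 1 \<Longrightarrow> i' + j' + k' \<ge> 1 \<Longrightarrow>
    Mon (i, j, k) = Mon (i', j', k') \<longleftrightarrow> i = i' \<and> j = j' \<and> k = k'"
  by (simp add: Mon_inject)

lemma Mon_cases:
  obtains i j k where "I = Mon (i, j, k)" "i \<le> 1" "j \<le> 1" "i + j + k \<ge> 1"
  by (cases I) auto

definition wt :: "'k::field_char_0 sf \<Rightarrow> mon \<Rightarrow> 'k" where
  "wt f I = ev (word_of I) f"

lemma word_of_counts:
  assumes "exponents I = (i, j, k)"
  shows "count_list (word_of I) W1 = i" "count_list (word_of I) W2 = j"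
    "count_list (word_of I) W3 = k" "inversions (word_of I) = 0" "word_of I \<noteq> []"
proof -
  have rep: "count_list (replicate n x) y = (if x = y then n else 0)" for n and x y :: gen
    by (induction n) auto
  have inv3: "inversions (replicate n W3) = 0" for n
    by (induction n) auto
  have inv23: "inversions (replicate n W2 @ replicate n' W3) = 0" for n n'
    by (induction n) (auto simp: inv3 rep)
  have "inversions (replicate n'' W1 @ replicate n W2 @ replicate n' W3) = 0" for n n' n''
    by (induction n'') (auto simp: inv23 rep)
  then show "count_list (word_of I) W1 = i" "count_list (word_of I) W2 = j"
    "count_list (word_of I) W3 = k" "inversions (word_of I) = 0"
    using assms by (auto simp: word_of_def rep)
  show "word_of I \<noteq> []"
    using exponents[of I] assms by (auto simp: word_of_def)
qed

lemma wt_eq_coeff: "wt f I = fact (snd (snd (exponents I))) * sf_coeff f (exponents I)"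
proof -
  obtain i j k where e: "exponents I = (i, j, k)" by (cases "exponents I") auto
  then have "i \<le> 1" "j \<le> 1" using exponents[of I] by auto
  then show ?thesis
    by (simp add: wt_def ev_eq_coeff word_of_counts[OF e] e)
qed

lemma length_eq_counts: "length v = count_list v W1 + count_list v W2 + count_list v W3"
proof (induction v)
  case (Cons x v)
  then show ?case by (cases x) auto
qed simp

lemma pairing_word_val:
  assumes "v \<noteq> []"
  shows "pairing (wt f) (word_val v) = ev v f"
proof (cases "count_list v W1 > 1 \<or> count_list v W2 > 1")
  case True
  then show ?thesis by (auto simp: word_val_def ev_eq_coeff)
next
  case False
  have "count_list v W1 + count_list v W2 + count_list v W3 \<ge> 1"
    using assms by (simp add: Suc_le_eq flip: length_eq_counts)
  with False have "exponents (Mon (count_list v W1, count_list v W2, count_list v W3)) =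
      (count_list v W1, count_list v W2, count_list v W3)"
    by (intro exponents_Mon) auto
  with False assms show ?thesis
    by (simp add: word_val_def ev_eq_coeff[of v] wt_eq_coeff flip: inversions_def)
qed

text \<open>The inverse of \<open>wt\<close> on functions without constant term. Dividing by the
  factorials is possible in characteristic zero.\<close>

definition sf_of :: "(mon \<Rightarrow> 'k::field_char_0) \<Rightarrow> 'k sf" where
  "sf_of w =
    (Abs_fps (\<lambda>k. if k = 0 then 0 else w (Mon (0, 0, k)) / fact k),
     Abs_fps (\<lambda>k. w (Mon (1, 0, k)) / fact k), Abs_fps (\<lambda>k. w (Mon (0, 1, k)) / fact k),
     Abs_fps (\<lambda>k. w (Mon (1, 1, k)) / fact k))"

lemma wt_sf_of [simp]: "wt (sf_of w) = w"
proof
  fix I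
  obtain i j k where I: "I = Mon (i, j, k)" "i \<le> 1" "j \<le> 1" "i + j + k \<ge> 1"
    by (rule Mon_cases)
  then have "i = 0 \<or> i = 1" "j = 0 \<or> j = 1" by auto
  then show "wt (sf_of w) I = w I"
    using I by (auto simp: wt_eq_coeff exponents_Mon sf_of_def)
qed

lemma sf_of_0 [simp]: "sf_coeff (sf_of w) (0, 0, 0) = 0"
  by (simp add: sf_of_def)

lemma sf_eqI:
  fixes f g :: "'k::field_char_0 sf"
  assumes "wt f = wt g" "sf_coeff f (0, 0, 0) = sf_coeff g (0, 0, 0)"
  shows "f = g"
proof -
  have eq: "sf_coeff f (i, j, k) = sf_coeff g (i, j, k)" if "i \<le> 1" "j \<le> 1" for i j k
  proof (cases "i + j + k \<ge> 1")
    case True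
    then show ?thesis
      using fun_cong[OF assms(1), of "Mon (i, j, k)"] that
      by (simp add: wt_eq_coeff exponents_Mon)
  next
    case False
    then have "i = 0" "j = 0" "k = 0" by auto
    then show ?thesis using assms(2) by simp
  qed
  obtain a b c d where f: "f = (a, b, c, d)" by (cases f) auto
  obtain a' b' c' d' where g: "g = (a', b', c', d')" by (cases g) auto
  show ?thesis
    unfolding f g
    using eq[of 0 0] eq[of 1 0] eq[of 0 1] eq[of 1 1] by (auto simp: f g fps_eq_iff)
qed

lemma pairing_wt_eqI:
  fixes x y :: "'k::field_char_0 SW"
  assumes "\<And>f. sf_coeff f (0, 0, 0) = 0 \<Longrightarrow> pairing (wt f) x = pairing (wt f) y"
  shows "x = y"
  by (rule pairing_eqI) (metis assms sf_of_0 wt_sf_of)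

section \<open>Coproduct and coderivations under duality\<close>

lemma letters_eq_Nil_iff: "letters v \<sigma> a b = [] \<longleftrightarrow> b \<le> a"
  by (auto simp: letters_def)

text \<open>The coproduct is dual to the product. The reduced coproduct omits k = 0 and k = n, where
  one factor is paired with the empty word; vanishing constant terms make these summands
  zero.\<close>

lemma pairing_comult:
  fixes f h :: "'k::field_char_0 sf"
  assumes "sf_coeff f (0, 0, 0) = 0" "sf_coeff h (0, 0, 0) = 0"
  shows "pairing (\<lambda>(I, J). wt f I * wt h J) (comult x) = pairing (wt (f \<odot> h)) x"
proof -
  let ?w = "\<lambda>(I, J). wt f I * wt h J"
  have "pairing ?w (\<Sum>k = 1..n - 1. \<Sum>\<sigma>\<in>unshuffles k n.
       scl (koszul v \<sigma>) (tensor (word_val (letters v \<sigma> 0 k)) (word_val (letters v \<sigma> k n)))) =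
     ev v (f \<odot> h)" if "length v = n" for v n
  proof -
    have "pairing ?w (\<Sum>k = 1..n - 1. \<Sum>\<sigma>\<in>unshuffles k n.
         scl (koszul v \<sigma>) (tensor (word_val (letters v \<sigma> 0 k)) (word_val (letters v \<sigma> k n)))) =
       (\<Sum>k = 1..n - 1. \<Sum>\<sigma>\<in>unshuffles k n.
         koszul v \<sigma> * ev (letters v \<sigma> 0 k) f * ev (letters v \<sigma> k n) h)"
      by (simp add: pairing_tensor)
         (intro sum.cong refl, auto simp: pairing_word_val letters_eq_Nil_iff)
    also have "\<dots> = (\<Sum>k\<le>n. \<Sum>\<sigma>\<in>unshuffles k n.
         koszul v \<sigma> * ev (letters v \<sigma> 0 k) f * ev (letters v \<sigma> k n) h)"
    proof (rule sum.mono_neutral_left)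
      show "\<forall>k\<in>{..n} - {1..n - 1}. (\<Sum>\<sigma>\<in>unshuffles k n.
         koszul v \<sigma> * ev (letters v \<sigma> 0 k) f * ev (letters v \<sigma> k n) h) = 0"
      proof
        fix k assume "k \<in> {..n} - {1..n - 1}"
        then have "k = 0 \<or> k = n" by auto
        then show "(\<Sum>\<sigma>\<in>unshuffles k n.
            koszul v \<sigma> * ev (letters v \<sigma> 0 k) f * ev (letters v \<sigma> k n) h) = 0"
          using assms by (auto simp: letters_def)
      qed
    qed auto
    also have "\<dots> = ev v (f \<odot> h)"
      using sum_unshuffles_eq_usum[OF that, of "\<lambda>s A B. s * ev A f * ev B h"]
      by (simp add: usum_ev_mult)
    finally show ?thesis .
  qed
  then show ?thesis
    by (simp add: comult_def Let_def wt_def[abs_def])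
qed

text \<open>The constant term of a function is not seen by the reduced algebra; here it is \<open>0\<close>.\<close>

definition comp_sf :: "gen \<Rightarrow> ('k::field_char_0 SW \<Rightarrow> 'k W) \<Rightarrow> 'k sf" where
  "comp_sf j \<phi> = sf_of (\<lambda>I. lookup (\<phi> (Poly_Mapping.single I 1)) j)"

definition vector_field :: "('k::field_char_0 SW \<Rightarrow> 'k W) \<Rightarrow> 'k sf \<Rightarrow> 'k sf" where
  "vector_field \<phi> f = comp_sf W1 \<phi> \<odot> sf_deriv W1 f + comp_sf W2 \<phi> \<odot> sf_deriv W2 f +
     comp_sf W3 \<phi> \<odot> sf_deriv W3 f"

lemma lookup_lin:
  assumes "lin \<phi>"
  shows "lookup (\<phi> x) j = pairing (wt (comp_sf j \<phi>)) x"
  using pairing_lin[OF assms, of "\<lambda>c. if c = j then 1 else 0" x]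
  by (simp add: comp_sf_def pairing_delta)

lemma UNIV_gen: "UNIV = {W1, W2, W3}"
  using gen.exhaust by auto

lemma finite_UNIV_gen: "finite (UNIV :: gen set)"
  by (simp add: UNIV_gen)

text \<open>The selected letters feed the coefficient of w_j in \<phi>, and the remaining ones
  differentiate the j-th derivative of \<open>f\<close>. By the Leibniz rule the sum is the pairing
  with the product of these two functions, summed over j.\<close>

lemma pairing_coder:
  fixes f :: "'k::field_char_0 sf"
  assumes "lin \<phi>"
  shows "pairing (wt f) (coder \<phi> x) = pairing (wt (vector_field \<phi> f)) x"
proof -
  have mw: "pairing (wt f) (mult_word u B) = (\<Sum>j\<in>UNIV. lookup u j * ev B (sf_deriv j f))" for u B
    by (simp add: mult_word_def pairing_word_val)
       (rule pairing_superset[OF finite_UNIV_gen], simp)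
  have "pairing (wt f) (\<Sum>k = 1..n. \<Sum>\<sigma>\<in>unshuffles k n.
       scl (koszul v \<sigma>) (mult_word (\<phi> (word_val (letters v \<sigma> 0 k))) (letters v \<sigma> k n))) =
     ev v (vector_field \<phi> f)" if "length v = n" for v n
  proof -
    let ?t = "\<lambda>j k \<sigma>. koszul v \<sigma> * ev (letters v \<sigma> 0 k) (comp_sf j \<phi>) * ev (letters v \<sigma> k n) (sf_deriv j f)"
    have "pairing (wt f) (\<Sum>k = 1..n. \<Sum>\<sigma>\<in>unshuffles k n.
         scl (koszul v \<sigma>) (mult_word (\<phi> (word_val (letters v \<sigma> 0 k))) (letters v \<sigma> k n))) =
       (\<Sum>k = 1..n. \<Sum>\<sigma>\<in>unshuffles k n. \<Sum>j\<in>UNIV. ?t j k \<sigma>)"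
      by (simp add: mw sum_distrib_left lookup_lin[OF assms])
         (intro sum.cong refl, auto simp: pairing_word_val letters_def)
    also have "\<dots> = (\<Sum>k\<le>n. \<Sum>\<sigma>\<in>unshuffles k n. \<Sum>j\<in>UNIV. ?t j k \<sigma>)"
    proof (rule sum.mono_neutral_left)
      show "\<forall>k\<in>{..n} - {1..n}. (\<Sum>\<sigma>\<in>unshuffles k n. \<Sum>j\<in>UNIV. ?t j k \<sigma>) = 0"
        by (auto simp: letters_def comp_sf_def not_less_eq_eq)
    qed auto
    also have "\<dots> = (\<Sum>j\<in>UNIV. \<Sum>k\<le>n. \<Sum>\<sigma>\<in>unshuffles k n. ?t j k \<sigma>)"
      by (simp only: UNIV_gen) (simp add: sum.distrib)
    also have "\<dots> = (\<Sum>j\<in>UNIV. ev v (comp_sf j \<phi> \<odot> sf_deriv j f))"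
      by (intro sum.cong refl)
        (rule sum_unshuffles_eq_usum[OF that, of "\<lambda>s A B. s * ev A (comp_sf _ \<phi>) * ev B (sf_deriv _ f)", unfolded usum_ev_mult])
    finally show ?thesis
      by (simp add: UNIV_gen vector_field_def add.assoc)
  qed
  then show ?thesis
    by (simp add: coder_def Let_def wt_def[of "vector_field \<phi> f", abs_def])
qed

section \<open>Coordinate changes linear over the even functions\<close>

text \<open>The substitution x \<mapsto> x, t1 \<mapsto> u t1, t2 \<mapsto> v t1 + w t2.\<close>

fun coord :: "'k::comm_ring_1 fps \<Rightarrow> 'k fps \<Rightarrow> 'k fps \<Rightarrow> 'k sf \<Rightarrow> 'k sf" where
  "coord u v w (a, b, c, d) = (a, u * b + v * c, w * c, u * w * d)"

lemma coord_mult: "coord u v w (f \<odot> g) = coord u v w f \<odot> coord u v w g"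
  by (cases f; cases g) (simp add: algebra_simps)

text \<open>The inverse of the triangular matrix with rows (u, v) and (0, w) has off-diagonal entry
  - u' v w'.\<close>

lemma coord_inverse:
  fixes u :: "'k::comm_ring_1 fps"
  assumes "u * u' = 1" "w * w' = 1"
  shows "coord u v w (coord u' (- (u' * v * w')) w' f) = f"
    and "coord u' (- (u' * v * w')) w' (coord u v w f) = f"
proof -
  have inv: "p * (q * z) = z" "q * (p * z) = z" if "p * q = 1" for p q z :: "'k fps"
  proof -
    have "p * (q * z) = (p * q) * z" "q * (p * z) = (p * q) * z"
      by (simp_all only: mult_ac)
    then show "p * (q * z) = z" "q * (p * z) = z"
      by (simp_all only: that mult_1)
  qed
  have uw: "u * (u' * z) = z" "u' * (u * z) = z" "w * (w' * z) = z" "w' * (w * z) = z" for z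
    by (fact inv[OF assms(1)] inv[OF assms(2)])+
  have "(u * w) * (u' * w') = (u * u') * (w * w')"
    by (simp only: mult_ac)
  then have "(u * w) * (u' * w') = 1"
    using assms by simp
  from inv[OF this] have "u * (w * (u' * (w' * z))) = z" "u' * (w' * (u * (w * z))) = z" for z
    by (simp_all only: mult.assoc)
  note eqs = uw this
  show "coord u v w (coord u' (- (u' * v * w')) w' f) = f"
    by (cases f) (simp add: distrib_left right_diff_distrib mult.assoc eqs)
  show "coord u' (- (u' * v * w')) w' (coord u v w f) = f"
    by (cases f) (simp add: distrib_left right_diff_distrib mult.assoc eqs)
qed

text \<open>The transpose of multiplication by \<open>p\<close>, applied to w1^i w2^j w3^n. The
  ratio n! / k! undoes the factorials in \<open>wt\<close>.\<close>

definition column :: "nat \<Rightarrow> nat \<Rightarrow> 'k::field_char_0 fps \<Rightarrow> nat \<Rightarrow> 'k SW" where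
  "column i j p n =
     (\<Sum>k\<le>n. Poly_Mapping.single (Mon (i, j, k)) (fact n / fact k * fps_nth p (n - k)))"

text \<open>The transpose of \<^const>\<open>coord\<close> under the pairing.\<close>

definition coord_dual ::
  "'k::field_char_0 fps \<Rightarrow> 'k fps \<Rightarrow> 'k fps \<Rightarrow> 'k SW \<Rightarrow> 'k SW" where
  "coord_dual u v w = lin_ext (\<lambda>I. case exponents I of (i, j, n) \<Rightarrow>
     if i = 0 then if j = 0 then Poly_Mapping.single I 1 else column 0 1 w n
     else if j = 0 then column 1 0 u n + column 0 1 v n else column 1 1 (u * w) n)"

lemma pairing_column:
  assumes "i \<le> 1" "j \<le> 1" "i + j \<ge> 1"
  shows "pairing (wt (a, b, c, d)) (column i j p n) =
    fact n * fps_nth (p * (if j = 0 then b else if i = 0 then c else d)) n"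
proof -
  have "i = 0 \<or> i = 1" "j = 0 \<or> j = 1" using assms by auto
  then show ?thesis
    using assms unfolding column_def
    by (subst mult.commute[of p])
       (auto simp: wt_eq_coeff exponents_Mon fps_mult_nth sum_distrib_left atLeast0AtMost
         intro!: sum.cong)
qed

lemma exponents_le: "exponents I = (i, j, k) \<Longrightarrow> i \<le> 1 \<and> j \<le> 1 \<and> i + j + k \<ge> 1"
  using exponents[of I] by auto

lemma pairing_coord_dual:
  "pairing (wt f) (coord_dual u v w x) = pairing (wt (coord u v w f)) x"
proof -
  obtain a b c d where f: "f = (a, b, c, d)" by (cases f) auto
  have "pairing (wt f) (case exponents I of (i, j, n) \<Rightarrow>
     if i = 0 then if j = 0 then Poly_Mapping.single I 1 else column 0 1 w n
     else if j = 0 then column 1 0 u n + column 0 1 v n else column 1 1 (u * w) n) =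
     wt (coord u v w f) I" for I
  proof -
    obtain i j k where e: "exponents I = (i, j, k)" by (cases "exponents I") auto
    from exponents_le[OF this] show ?thesis
      by (auto simp: f e pairing_column wt_eq_coeff algebra_simps)
  qed
  then show ?thesis by (simp add: coord_dual_def)
qed

lemma coord_dual_inverse:
  assumes "u * u' = 1" "w * w' = 1"
  shows "coord_dual u v w (coord_dual u' (- (u' * v * w')) w' x) = x"
    and "coord_dual u' (- (u' * v * w')) w' (coord_dual u v w x) = x"
  by (rule pairing_wt_eqI; simp add: pairing_coord_dual coord_inverse[OF assms])+

section \<open>Parity and coproduct of the transposed maps\<close>

lemma homogeneous_add: "homogeneous par p x \<Longrightarrow> homogeneous par p y \<Longrightarrow> homogeneous par p (x + y)"
  using Poly_Mapping.keys_add[of x y] by (auto simp: homogeneous_def)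

lemma homogeneous_sum: "(\<And>i. i \<in> A \<Longrightarrow> homogeneous par p (h i)) \<Longrightarrow> homogeneous par p (\<Sum>i\<in>A. h i)"
  by (induction A rule: infinite_finite_induct)
     (auto intro: homogeneous_add simp: homogeneous_def[of _ _ 0])

lemma homogeneous_single: "par b = p \<Longrightarrow> homogeneous par p (Poly_Mapping.single b c)"
  by (simp add: homogeneous_def)

lemma pairing_eq_0: "(\<And>b. b \<in> keys x \<Longrightarrow> w b = 0) \<Longrightarrow> pairing w x = 0"
  by (simp add: pairing_def)

lemma even_map_lin_ext:
  fixes F :: "'a \<Rightarrow> ('c \<Rightarrow>\<^sub>0 'b::field)"
  assumes "\<And>b. homogeneous par' (par b) (F b)"
  shows "even_map par par' (lin_ext F)"
  unfolding even_map_def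
proof (intro allI impI)
  fix p and x :: "'a \<Rightarrow>\<^sub>0 'b" assume x: "homogeneous par p x"
  show "homogeneous par' p (lin_ext F x)"
    unfolding homogeneous_def
  proof (rule ballI, rule ccontr)
    fix c assume c: "c \<in> keys (lin_ext F x)" "par' c \<noteq> p"
    have "lookup (lin_ext F x) c = 0"
      unfolding lookup_lin_ext
    proof (rule pairing_eq_0)
      fix b assume "b \<in> keys x"
      then have "par b = p" using x by (simp add: homogeneous_def)
      then show "lookup (F b) c = 0"
        using assms[of b] c(2) by (auto simp: homogeneous_def in_keys_iff)
    qed
    with c show False by (simp add: in_keys_iff)
  qed
qed

lemma mon_odd_Mon:
  "i \<le> 1 \<Longrightarrow> j \<le> 1 \<Longrightarrow> i + j + k \<ge> 1 \<Longrightarrow> mon_odd (Mon (i, j, k)) = odd (i + j)"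
  by (simp add: mon_odd_def exponents_Mon)

lemma homogeneous_column:
  "i \<le> 1 \<Longrightarrow> j \<le> 1 \<Longrightarrow> i + j \<ge> 1 \<Longrightarrow> p = odd (i + j) \<Longrightarrow> homogeneous mon_odd p (column i j q n)"
  unfolding column_def by (intro homogeneous_sum homogeneous_single) (simp add: mon_odd_Mon)

lemma even_map_coord_dual: "even_map mon_odd mon_odd (coord_dual u v w)"
  unfolding coord_dual_def
proof (rule even_map_lin_ext)
  fix I
  obtain i j k where e: "exponents I = (i, j, k)" by (cases "exponents I") auto
  from exponents_le[OF this]
  show "homogeneous mon_odd (mon_odd I) (case exponents I of (i, j, n) \<Rightarrow>
     if i = 0 then if j = 0 then Poly_Mapping.single I 1 else column 0 1 w n
     else if j = 0 then column 1 0 u n + column 0 1 v n else column 1 1 (u * w) n)"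
    by (auto simp: e mon_odd_def[of I] intro!: homogeneous_add homogeneous_column homogeneous_single)
qed

lemma lin_coord_dual: "lin (coord_dual u v w)"
  unfolding coord_dual_def by (rule lin_lin_ext)

text \<open>Paired with a product of functionals \<open>wt f\<close> and \<open>wt h\<close>, both
  sides become the pairing of x with G f \<odot> G h: the transpose of a multiplicative map respects
  coproducts.\<close>

lemma comult_comm_tensor_map:
  fixes g :: "'k::field_char_0 SW \<Rightarrow> 'k SW"
  assumes G: "\<And>f x. pairing (wt f) (g x) = pairing (wt (G f)) x"
    and G0: "\<And>f. sf_coeff f (0, 0, 0) = 0 \<Longrightarrow> sf_coeff (G f) (0, 0, 0) = 0"
    and mult: "\<And>f h. G (f \<odot> h) = G f \<odot> G h"
  shows "comult (g x) = tensor_map g g (comult x)"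
proof (rule pairing_prod_eqI)
  fix w w' :: "mon \<Rightarrow> 'k"
  define f h where "f = sf_of w" and "h = sf_of w'"
  have 0: "sf_coeff f (0, 0, 0) = 0" "sf_coeff h (0, 0, 0) = 0"
    by (auto simp: f_def h_def simp del: sf_coeff.simps)
  have "pairing (\<lambda>(a, b). wt f a * wt h b) (comult (g x)) =
      pairing (\<lambda>(a, b). wt f a * wt h b) (tensor_map g g (comult x))"
    using 0 G0[OF 0(1)] G0[OF 0(2)] by (simp add: pairing_comult pairing_tensor_map G mult)
  then show "pairing (\<lambda>(a, b). w a * w' b) (comult (g x)) =
      pairing (\<lambda>(a, b). w a * w' b) (tensor_map g g (comult x))"
    by (simp add: f_def h_def)
qed

lemma coalgebra_automorphism_coord_dual:
  assumes "fps_nth u 0 \<noteq> 0" "fps_nth w 0 \<noteq> 0"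
  shows "coalgebra_automorphism (coord_dual u v w)"
proof -
  have "u * inverse u = 1" "w * inverse w = 1"
    using assms by (simp_all add: inverse_mult_eq_1')
  note inv = coord_dual_inverse[OF this]
  have "bij (coord_dual u v w)"
    by (rule o_bij[of "coord_dual (inverse u) (- (inverse u * v * inverse w)) (inverse w)"])
       (simp_all only: fun_eq_iff o_apply id_apply inv simp_thms)
  moreover have "comult (coord_dual u v w x) =
      tensor_map (coord_dual u v w) (coord_dual u v w) (comult x)" for x
  proof (rule comult_comm_tensor_map[where G = "coord u v w"])
    show "sf_coeff (coord u v w f) (0, 0, 0) = 0" if "sf_coeff f (0, 0, 0) = 0" for f
      using that by (cases f) simp
  qed (rule pairing_coord_dual coord_mult)+
  ultimately show ?thesis
    by (simp add: coalgebra_automorphism_def lin_coord_dual even_map_coord_dual)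
qed

text \<open>Transposition reverses composition, so the hypothesis gives coder d' \<circ> g = g
  \<circ> coder d for the transpose \<open>g\<close> of \<open>coord u v w\<close>. The automorphism
  witnessing the equivalence is therefore the inverse \<open>g'\<close>.\<close>

lemma equivalent_by_coord:
  assumes "lin d" "lin d'" and u: "fps_nth u 0 \<noteq> 0" and w: "fps_nth w 0 \<noteq> 0"
    and eq: "\<And>f. vector_field d (coord u v w f) = coord u v w (vector_field d' f)"
  shows "equivalent d d'"
proof -
  define g where "g = coord_dual u v w"
  define g' where "g' = coord_dual (inverse u) (- (inverse u * v * inverse w)) (inverse w)"
  have "u * inverse u = 1" "w * inverse w = 1"
    using u w by (simp_all add: inverse_mult_eq_1')
  then have inv: "g (g' x) = x" "g' (g x) = x" for x
    unfolding g_def g'_def by (rule coord_dual_inverse)+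
  have "coder d' (g x) = g (coder d x)" for x
    by (rule pairing_wt_eqI) (simp add: pairing_coder assms(1,2) g_def pairing_coord_dual eq)
  then have "coder d' = g \<circ> coder d \<circ> g'"
    by (simp add: fun_eq_iff inv(1) flip: \<open>\<And>x. coder d' (g x) = g (coder d x)\<close>)
  moreover have "inv g' = g"
    by (rule inv_equality) (simp_all add: inv)
  moreover have "coalgebra_automorphism g'"
    unfolding g'_def using u w by (intro coalgebra_automorphism_coord_dual) simp_all
  ultimately show ?thesis
    unfolding equivalent_def by auto
qed

section \<open>Codifferentials as odd vector fields\<close>

lemma cochain_odd_iff:
  fixes \<phi> :: "'k::field_char_0 SW \<Rightarrow> 'k W"
  assumes "lin \<phi>"
  shows "cochain_odd \<phi> \<longleftrightarrow> (\<forall>I j. mon_odd I = gen_odd j \<longrightarrow> wt (comp_sf j \<phi>) I = 0)"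
proof
  assume odd: "cochain_odd \<phi>"
  show "\<forall>I j. mon_odd I = gen_odd j \<longrightarrow> wt (comp_sf j \<phi>) I = 0"
  proof (intro allI impI)
    fix I j assume "mon_odd I = gen_odd j"
    moreover have "homogeneous gen_odd (\<not> mon_odd I) (\<phi> (Poly_Mapping.single I 1))"
      using odd unfolding cochain_odd_def odd_map_def
      by (simp add: homogeneous_single)
    ultimately show "wt (comp_sf j \<phi>) I = 0"
      by (auto simp: comp_sf_def homogeneous_def in_keys_iff)
  qed
next
  assume R: "\<forall>I j. mon_odd I = gen_odd j \<longrightarrow> wt (comp_sf j \<phi>) I = 0"
  show "cochain_odd \<phi>"
    unfolding cochain_odd_def odd_map_def
  proof (intro allI impI)
    fix p and x :: "'k SW" assume x: "homogeneous mon_odd p x"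
    show "homogeneous gen_odd (\<not> p) (\<phi> x)"
      unfolding homogeneous_def
    proof (rule ballI, rule ccontr)
      fix j assume j: "j \<in> keys (\<phi> x)" "gen_odd j \<noteq> (\<not> p)"
      have "lookup (\<phi> x) j = 0"
        unfolding lookup_lin[OF assms]
        by (rule pairing_eq_0) (use x j R in \<open>auto simp: homogeneous_def\<close>)
      with j show False by (simp add: in_keys_iff)
    qed
  qed
qed

text \<open>Notation for an odd vector field Q: Q t1 = f1 + g1 t1 t2, Q t2 = f2 + g2 t1 t2 and Q x =
  h1 t1 + h2 t2.\<close>

definition odd_comps ::
  "('k::field_char_0 SW \<Rightarrow> 'k W) \<Rightarrow> 'k fps \<Rightarrow> 'k fps \<Rightarrow> 'k fps \<Rightarrow> 'k fps \<Rightarrow> 'k fps \<Rightarrow> 'k fps \<Rightarrow> bool" where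
  "odd_comps d f1 g1 f2 g2 h1 h2 \<longleftrightarrow> comp_sf W1 d = (f1, 0, 0, g1) \<and>
     comp_sf W2 d = (f2, 0, 0, g2) \<and> comp_sf W3 d = (0, h1, h2, 0)"

lemma cochain_odd_iff_odd_comps:
  assumes "lin d"
  shows "cochain_odd d \<longleftrightarrow> (\<exists>f1 g1 f2 g2 h1 h2. odd_comps d f1 g1 f2 g2 h1 h2)"
proof
  assume "cochain_odd d"
  then have 0: "wt (comp_sf j d) I = 0" if "mon_odd I = gen_odd j" for I j
    using that assms by (simp add: cochain_odd_iff)
  have odd: "fst (snd f) = 0 \<and> fst (snd (snd f)) = 0" if "\<And>I. mon_odd I \<Longrightarrow> wt f I = 0" for f :: "'a sf"
  proof -
    obtain a b c e where f: "f = (a, b, c, e)" by (cases f) auto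
    have "fps_nth b k = 0" "fps_nth c k = 0" for k
      using that[of "Mon (1, 0, k)"] that[of "Mon (0, 1, k)"]
      by (simp_all add: mon_odd_Mon wt_eq_coeff exponents_Mon f)
    then show ?thesis by (simp add: f fps_eq_iff)
  qed
  have even: "fst f = 0 \<and> snd (snd (snd f)) = 0"
    if "\<And>I. \<not> mon_odd I \<Longrightarrow> wt f I = 0" "sf_coeff f (0, 0, 0) = 0" for f :: "'a sf"
  proof -
    obtain a b c e where f: "f = (a, b, c, e)" by (cases f) auto
    have "fps_nth e k = 0" for k
      using that(1)[of "Mon (1, 1, k)"] by (simp add: mon_odd_Mon wt_eq_coeff exponents_Mon f)
    moreover have "fps_nth a k = 0" for k
      using that(1)[of "Mon (0, 0, k)"] that(2)
      by (cases k) (simp_all add: mon_odd_Mon wt_eq_coeff exponents_Mon f del: fact_Suc)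
    ultimately show ?thesis by (simp add: f fps_eq_iff)
  qed
  have "sf_coeff (comp_sf W3 d) (0, 0, 0) = 0" by (simp only: comp_sf_def sf_of_0)
  then have 3: "fst (comp_sf W3 d) = 0 \<and> snd (snd (snd (comp_sf W3 d))) = 0"
    using 0 by (intro even) auto
  have 12: "fst (snd (comp_sf j d)) = 0 \<and> fst (snd (snd (comp_sf j d))) = 0" if "gen_odd j" for j
    using 0 that by (intro odd) auto
  show "\<exists>f1 g1 f2 g2 h1 h2. odd_comps d f1 g1 f2 g2 h1 h2"
    unfolding odd_comps_def using 3 12[of W1] 12[of W2]
    by (cases "comp_sf W1 d"; cases "comp_sf W2 d"; cases "comp_sf W3 d") auto
next
  assume "\<exists>f1 g1 f2 g2 h1 h2. odd_comps d f1 g1 f2 g2 h1 h2"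
  then obtain f1 g1 f2 g2 h1 h2 where c: "odd_comps d f1 g1 f2 g2 h1 h2" by blast
  show "cochain_odd d"
    unfolding cochain_odd_iff[OF assms]
  proof (intro allI impI)
    fix I j assume p: "mon_odd I = gen_odd j"
    obtain i i' k where "exponents I = (i, i', k)" by (cases "exponents I") auto
    moreover from exponents_le[OF this] have "i = 0 \<or> i = 1" "i' = 0 \<or> i' = 1" by auto
    ultimately show "wt (comp_sf j d) I = 0"
      using p c by (cases j) (auto simp: odd_comps_def mon_odd_def wt_eq_coeff)
  qed
qed

lemma vector_field_odd:
  assumes "odd_comps d f1 g1 f2 g2 h1 h2"
  shows "vector_field d (a, b, c, e) =
    (f1 * b + f2 * c, h1 * fps_deriv a - f2 * e, f1 * e + h2 * fps_deriv a,
     g1 * b + g2 * c + h1 * fps_deriv c - h2 * fps_deriv b)"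
  using assms by (simp add: vector_field_def odd_comps_def algebra_simps)

text \<open>For odd d the bracket is twice \<open>d\<close> after \<open>coder d\<close>, and 2 is
  invertible. The coefficient of w_j in the composite is the functional of Q applied twice to the
  j-th coordinate, where Q is the vector field of d.\<close>

lemma codifferential_iff:
  fixes d :: "'k::field_char_0 SW \<Rightarrow> 'k W"
  assumes "lin d" "cochain_odd d"
  shows "codifferential d \<longleftrightarrow> (\<forall>j. vector_field d (comp_sf j d) = 0)"
proof -
  have b: "lookup (bracket d d x) j = 2 * pairing (wt (vector_field d (comp_sf j d))) x" for x j
    using assms
    by (simp add: bracket_def lookup_minus lookup_lin[OF assms(1)] pairing_coder[OF assms(1)])
  have wt0: "wt (0 :: 'k sf) = (\<lambda>I. 0)"
    by (simp add: fun_eq_iff wt_def)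
  \<comment> \<open>Constant terms are invisible to \<open>wt\<close>, so this one is computed
    separately; it vanishes because the coefficients of the vector field have none.\<close>
  have 0: "sf_coeff (vector_field d (comp_sf j d)) (0, 0, 0) = 0" for j
  proof -
    have "sf_coeff (f \<odot> f') (0, 0, 0) = sf_coeff f (0, 0, 0) * sf_coeff f' (0, 0, 0)"
      and "sf_coeff (f + f') (0, 0, 0) = sf_coeff f (0, 0, 0) + sf_coeff f' (0, 0, 0)" for f f' :: "'k sf"
      by (cases f; cases f'; simp)+
    then show ?thesis
      by (simp add: vector_field_def comp_sf_def del: sf_coeff.simps)
  qed
  have "codifferential d \<longleftrightarrow> (\<forall>j x. lookup (bracket d d x) j = 0)"
    using assms by (auto simp: codifferential_def L_def fun_eq_iff poly_mapping_eq_iff)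
  also have "\<dots> \<longleftrightarrow> (\<forall>j. wt (vector_field d (comp_sf j d)) = (\<lambda>I. 0))"
  proof -
    have "(\<forall>x. pairing w x = 0) \<longleftrightarrow> w = (\<lambda>I. 0)" for w :: "mon \<Rightarrow> 'k"
      by (metis mult_1 pairing_const_zero pairing_single)
    then show ?thesis by (simp add: b)
  qed
  also have "\<dots> \<longleftrightarrow> (\<forall>j. vector_field d (comp_sf j d) = 0)"
  proof -
    have "sf_coeff (0 :: 'k sf) (0, 0, 0) = 0" by (simp add: zero_prod_def)
    then have "f = 0 \<longleftrightarrow> wt f = (\<lambda>I. 0)" if "sf_coeff f (0, 0, 0) = 0" for f :: "'k sf"
      using sf_eqI[of f 0] that wt0 by auto
    then show ?thesis using 0 by simp
  qed
  finally show ?thesis .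
qed

lemma all_gen: "(\<forall>j. P j) \<longleftrightarrow> P W1 \<and> P W2 \<and> P W3"
  by (metis gen.exhaust)

text \<open>The equations are the coefficients of Q^2 t1, Q^2 t2 and Q^2 x, two for each.\<close>

lemma codifferential_odd_comps:
  fixes d :: "'k::field_char_0 SW \<Rightarrow> 'k W"
  assumes "lin d" and c: "odd_comps d f1 g1 f2 g2 h1 h2"
  shows "codifferential d \<longleftrightarrow>
    h1 * fps_deriv f1 = f2 * g1 \<and> f1 * g1 + h2 * fps_deriv f1 = 0 \<and>
    h1 * fps_deriv f2 = f2 * g2 \<and> f1 * g2 + h2 * fps_deriv f2 = 0 \<and>
    f1 * h1 + f2 * h2 = 0 \<and> g1 * h1 + g2 * h2 + h1 * fps_deriv h2 - h2 * fps_deriv h1 = 0"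
proof -
  have "cochain_odd d"
    using c cochain_odd_iff_odd_comps[OF assms(1)] by blast
  then show ?thesis
    using c by (auto simp: codifferential_iff[OF assms(1)] all_gen odd_comps_def
        vector_field_odd[OF c] zero_prod_def)
qed

section \<open>The normal form\<close>

lemma comp_sf_eq:
  assumes "\<And>I. wt f I = lookup (d (Poly_Mapping.single I 1)) j" "sf_coeff f (0, 0, 0) = 0"
  shows "comp_sf j d = f"
  using assms by (intro sf_eqI) (auto simp: comp_sf_def simp del: sf_coeff.simps)

lemma lookup_phi_single:
  "lookup (phi i1 i2 i3 j (Poly_Mapping.single I 1)) j' =
    (if exponents I = (i1, i2, i3) \<and> j = j' then fact i1 * fact i2 * fact i3 else 0)"
  by (simp add: phi_def lookup_single when_def)

lemma lin_phi: "lin (phi i1 i2 i3 j)"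
  unfolding phi_def by (rule lin_lin_ext)

lemma lin_d_lam: "lin (d_lam m l)"
  unfolding d_lam_def lin_iff
  by (auto simp: lin_phi[unfolded lin_iff, THEN conjunct1, rule_format]
      lin_phi[unfolded lin_iff, THEN conjunct2, rule_format] lookup_add algebra_simps
      intro!: poly_mapping_eqI)

lemma lin_d_lam_e: "lin (d_lam_e m n)"
  unfolding d_lam_e_def lin_iff
  by (auto simp: lin_phi[unfolded lin_iff, THEN conjunct1, rule_format]
      lin_phi[unfolded lin_iff, THEN conjunct2, rule_format] lookup_add lookup_minus algebra_simps
      intro!: poly_mapping_eqI)

text \<open>The factor I! in \<open>phi\<close> equals the one in \<open>wt\<close>, so the
  coefficient function of \<open>phi i1 i2 i3 j\<close> is the plain monomial t1^i1 t2^i2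
  x^i3.\<close>

lemma odd_comps_d_lam:
  "odd_comps (d_lam m l) 0 (fps_const l * fps_X ^ m) 0 0 0 (fps_X ^ (m + 1))"
  unfolding odd_comps_def
proof (intro conjI; rule comp_sf_eq)
  fix I
  obtain i j k where e: "exponents I = (i, j, k)" by (cases "exponents I") auto
  from exponents_le[OF this] have ij: "i = 0 \<or> i = 1" "j = 0 \<or> j = 1" by auto
  show "wt (0, 0, 0, fps_const l * fps_X ^ m) I = lookup (d_lam m l (Poly_Mapping.single I 1)) W1"
    and "wt (0, 0, 0, 0) I = lookup (d_lam m l (Poly_Mapping.single I 1)) W2"
    and "wt (0, 0, fps_X ^ (m + 1), 0) I = lookup (d_lam m l (Poly_Mapping.single I 1)) W3"
    using ij by (auto simp: wt_eq_coeff e d_lam_def lookup_add lookup_phi_single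
        simp del: fact_Suc power_Suc)
qed auto

lemma odd_comps_d_lam_e:
  "odd_comps (d_lam_e m n) (fps_X ^ (n + 2)) (fps_const (- (of_nat n + 2)) * fps_X ^ m) 0 0 0
     (fps_X ^ (m + 1))"
  unfolding odd_comps_def
proof (intro conjI; rule comp_sf_eq)
  fix I
  obtain i j k where e: "exponents I = (i, j, k)" by (cases "exponents I") auto
  from exponents_le[OF this] have ij: "i = 0 \<or> i = 1" "j = 0 \<or> j = 1" by auto
  show "wt (fps_X ^ (n + 2), 0, 0, fps_const (- (of_nat n + 2)) * fps_X ^ m) I =
      lookup (d_lam_e m n (Poly_Mapping.single I 1)) W1"
    and "wt (0, 0, 0, 0) I = lookup (d_lam_e m n (Poly_Mapping.single I 1)) W2"
    and "wt (0, 0, fps_X ^ (m + 1), 0) I = lookup (d_lam_e m n (Poly_Mapping.single I 1)) W3"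
    using ij by (auto simp: wt_eq_coeff e d_lam_e_def lookup_add lookup_minus lookup_phi_single algebra_simps
        simp del: fact_Suc power_Suc fps_const_neg fps_const_add fps_const_sub)
qed auto

lemma codifferential_d_lam: "codifferential (d_lam m (l :: 'k::field_char_0))"
  unfolding codifferential_odd_comps[OF lin_d_lam odd_comps_d_lam] by simp

lemma codifferential_d_lam_e: "codifferential (d_lam_e m n :: 'k::field_char_0 SW \<Rightarrow> 'k W)"
proof -
  \<comment> \<open>This is the t2 part of Q^2 t1, with c = n + 2 coming from the derivative of
    x^(n+2); the value of \<lambda> is what makes it cancel.\<close>
  have "fps_X ^ (n + 2) * (fps_const (- c) * fps_X ^ m) +
      fps_X ^ (m + 1) * (fps_const c * fps_X ^ (n + 1)) = 0" for c :: 'k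
    by (simp add: power_add algebra_simps flip: fps_const_neg)
  moreover have "fps_deriv (fps_X ^ (n + 2)) = fps_const (of_nat n + 2) * (fps_X ^ (n + 1) :: 'k fps)"
    by (rule fps_ext) (auto simp: fps_mult_left_const_nth fps_X_power_nth simp del: power_Suc)
  ultimately have "fps_X ^ (n + 2) * (fps_const (- (of_nat n + 2)) * fps_X ^ m) +
      fps_X ^ (m + 1) * fps_deriv (fps_X ^ (n + 2)) = (0 :: 'k fps)"
    by (simp only:)
  then show ?thesis
    unfolding codifferential_odd_comps[OF lin_d_lam_e odd_comps_d_lam_e]
    by (simp del: power_Suc power_add add_2_eq_Suc')
qed

section \<open>Extensions as codifferentials that agree on short monomials\<close>

lemma component_single:
  "component k \<phi> (Poly_Mapping.single I 1) =
     (if mon_size I = k then \<phi> (Poly_Mapping.single I 1) else 0)"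
  by (auto simp: component_def intro!: poly_mapping_eqI)

lemma lin_ext_eqI:
  "lin f \<Longrightarrow> lin g \<Longrightarrow> (\<And>b. f (Poly_Mapping.single b 1) = g (Poly_Mapping.single b 1)) \<Longrightarrow> f = g"
  by (rule ext, subst lin_eq_lin_ext[of f], assumption, subst lin_eq_lin_ext[of g], assumption, simp)

lemma lin_component: "lin (component k \<phi>)"
  unfolding component_def by (rule lin_lin_ext)

lemma lin_zero: "lin (\<lambda>x. 0)"
  by (auto simp: lin_iff intro!: poly_mapping_eqI)

text \<open>Linear maps are determined on monomials. Since \<open>dN\<close> vanishes on those
  shorter than N, the conditions below N and at N merge into agreement up to length N.\<close>

lemma is_extension_iff:
  assumes "lin d" "lin dN"
  shows "is_extension N dN d \<longleftrightarrow> codifferential dN \<and> codifferential d \<and>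
    (\<forall>I. mon_size I \<noteq> N \<longrightarrow> dN (Poly_Mapping.single I 1) = 0) \<and>
    (\<forall>I. mon_size I \<le> N \<longrightarrow> d (Poly_Mapping.single I 1) = dN (Poly_Mapping.single I 1))"
proof -
  have "component k d = (\<lambda>x. 0) \<longleftrightarrow> (\<forall>I. mon_size I = k \<longrightarrow> d (Poly_Mapping.single I 1) = 0)" for k
  proof
    assume "component k d = (\<lambda>x. 0)"
    then show "\<forall>I. mon_size I = k \<longrightarrow> d (Poly_Mapping.single I 1) = 0"
      by (metis component_single)
  next
    assume "\<forall>I. mon_size I = k \<longrightarrow> d (Poly_Mapping.single I 1) = 0"
    then show "component k d = (\<lambda>x. 0)"
      by (intro lin_ext_eqI lin_component lin_zero) (simp add: component_single)
  qed
  moreover have "component N d = dN \<longleftrightarrow>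
      (\<forall>I. mon_size I = N \<longrightarrow> d (Poly_Mapping.single I 1) = dN (Poly_Mapping.single I 1))"
    if "\<forall>I. mon_size I \<noteq> N \<longrightarrow> dN (Poly_Mapping.single I 1) = 0"
  proof
    assume "component N d = dN"
    then show "\<forall>I. mon_size I = N \<longrightarrow> d (Poly_Mapping.single I 1) = dN (Poly_Mapping.single I 1)"
      by (metis component_single)
  next
    assume "\<forall>I. mon_size I = N \<longrightarrow> d (Poly_Mapping.single I 1) = dN (Poly_Mapping.single I 1)"
    then show "component N d = dN"
      using that by (intro lin_ext_eqI lin_component assms) (simp add: component_single)
  qed
  ultimately show ?thesis
    unfolding is_extension_def L_deg_def L_def using assms(2)
    by (auto simp: le_less)
qed

lemma d_lam_eq_0:
  fixes l :: "'k::field_char_0"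
  assumes "mon_size I \<noteq> m + 2"
  shows "d_lam m l (Poly_Mapping.single I 1) = 0"
  using assms
  by (intro poly_mapping_eqI) (auto simp: d_lam_def lookup_add lookup_phi_single mon_size_def)

text \<open>The added term has degree n + 2, which exceeds m + 2 exactly when n > m.\<close>

lemma is_extension_d_lam_e:
  assumes "n > m"
  shows "is_extension (m + 2) (d_lam m (- (of_nat n + 2) :: 'k::field_char_0)) (d_lam_e m n)"
  unfolding is_extension_iff[OF lin_d_lam_e lin_d_lam]
proof (intro conjI allI impI)
  fix I assume I: "mon_size I \<le> m + 2"
  show "(d_lam_e m n (Poly_Mapping.single I 1) :: 'k W) = d_lam m (- (of_nat n + 2)) (Poly_Mapping.single I 1)"
    using I assms
    by (intro poly_mapping_eqI)
       (auto simp: d_lam_def d_lam_e_def lookup_add lookup_minus lookup_phi_single mon_size_def algebra_simps)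
qed (auto simp: codifferential_d_lam codifferential_d_lam_e d_lam_eq_0)

text \<open>The solution is the exponential of the antiderivative of \<open>p\<close> with zero
  constant term, which makes the composition meaningful and the value at 0 equal to 1.\<close>

lemma fps_linear_ode:
  fixes p :: "'k::field_char_0 fps"
  obtains u where "fps_nth u 0 = 1" "fps_deriv u = p * u"
proof
  let ?u = "fps_exp 1 oo fps_integral0 p"
  show "fps_nth ?u 0 = 1" by simp
  show "fps_deriv ?u = p * ?u"
    by (simp add: fps_compose_deriv fps_deriv_fps_integral mult.commute)
qed

lemma fps_eq_X_power_times:
  assumes "\<And>k. k < n \<Longrightarrow> fps_nth f k = 0"
  shows "f = fps_X ^ n * fps_shift n f"
  by (rule fps_ext) (use assms in \<open>auto simp: fps_X_power_mult_nth\<close>)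

text \<open>Put t1' = u t1 and t2' = v t1 + w t2. The equations then say Q x = x^(m+1) t2'; that
  both parts of Q t2' vanish; and that the t1 t2 part of Q t1' is \<lambda> x^m t1' t2'. The
  remaining part of Q t1' is \<open>f1 * u\<close>, which satisfies an Euler equation and has order
  at least m + 3.\<close>

lemma extension_normal_form:
  fixes l :: "'k::field_char_0"
  assumes ext: "is_extension (m + 2) (d_lam m l) d"
  obtains f1 g1 f2 g2 h1 h2 u v w where "lin d" "odd_comps d f1 g1 f2 g2 h1 h2"
    "fps_nth u 0 = 1" "fps_nth w 0 = 1"
    "h1 = fps_X ^ (m + 1) * v" "h2 = fps_X ^ (m + 1) * w"
    "f1 * v + f2 * w = 0" "g1 * v + g2 * w + h1 * fps_deriv w - h2 * fps_deriv v = 0"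
    "g1 * u - h2 * fps_deriv u = u * w * (fps_const l * fps_X ^ m)"
    "fps_X * fps_deriv (f1 * u) = - fps_const l * (f1 * u)"
    "\<And>k. k < m + 3 \<Longrightarrow> fps_nth (f1 * u) k = 0"
proof -
  have lin: "lin d"
    using ext by (simp add: is_extension_def codifferential_def L_def)
  have cod: "codifferential d"
    using ext by (simp add: is_extension_def)
  then obtain f1 g1 f2 g2 h1 h2 where c: "odd_comps d f1 g1 f2 g2 h1 h2"
    using cochain_odd_iff_odd_comps[OF lin] by (metis codifferential_def)
  have low: "sf_coeff (comp_sf j d) (i1, i2, i3) = sf_coeff (comp_sf j (d_lam m l)) (i1, i2, i3)"
    if "i1 \<le> 1" "i2 \<le> 1" "i1 + i2 + i3 \<le> m + 2" for i1 i2 i3 j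
  proof (cases "i1 + i2 + i3 = 0")
    case True
    then show ?thesis by (simp add: comp_sf_def del: sf_coeff.simps)
  next
    case False
    let ?I = "Mon (i1, i2, i3)"
    have e: "exponents ?I = (i1, i2, i3)" using that False by (intro exponents_Mon) auto
    then have "wt (comp_sf j d) ?I = wt (comp_sf j (d_lam m l)) ?I"
      using ext that unfolding is_extension_iff[OF lin lin_d_lam]
      by (simp add: comp_sf_def mon_size_def)
    then show ?thesis by (simp add: wt_eq_coeff e)
  qed
  note c' = odd_comps_d_lam[of m l]
  \<comment> \<open>Odd letters count towards the degree: agreement up to degree m + 2 controls
    \<open>f1\<close> up to order m + 2, \<open>h1\<close> and \<open>h2\<close> up to m + 1, and
    \<open>g1\<close> up to m.\<close>
  have f1: "fps_nth f1 k = 0" if "k < m + 3" for k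
    using low[of 0 0 k W1] that c c' by (simp add: odd_comps_def)
  have g1: "fps_nth g1 k = (if k = m then l else 0)" if "k < m + 1" for k
    using low[of 1 1 k W1] that c c' by (simp add: odd_comps_def)
  have h1: "fps_nth h1 k = 0" if "k < m + 2" for k
    using low[of 1 0 k W3] that c c' by (simp add: odd_comps_def)
  have h2: "fps_nth h2 k = (if k = m + 1 then 1 else 0)" if "k < m + 2" for k
    using low[of 0 1 k W3] that c c' by (simp add: odd_comps_def del: power_Suc)
  define v where "v = fps_shift (m + 1) h1"
  define w where "w = fps_shift (m + 1) h2"
  define s where "s = fps_shift m g1"
  have h1v: "h1 = fps_X ^ (m + 1) * v"
    unfolding v_def by (rule fps_eq_X_power_times) (simp add: h1)
  have h2w: "h2 = fps_X ^ (m + 1) * w"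
    unfolding w_def by (rule fps_eq_X_power_times) (simp add: h2)
  have g1s: "g1 = fps_X ^ m * s"
    unfolding s_def by (rule fps_eq_X_power_times) (simp add: g1)
  have w0: "fps_nth w 0 = 1" by (simp add: w_def h2)
  have s0: "fps_nth s 0 = l" by (simp add: s_def g1)
  have X0: "fps_X ^ (m + 1) \<noteq> (0 :: 'k fps)" by simp
  have eqs: "f1 * g1 + h2 * fps_deriv f1 = 0" "f1 * h1 + f2 * h2 = 0"
    "g1 * h1 + g2 * h2 + h1 * fps_deriv h2 - h2 * fps_deriv h1 = 0"
    using cod unfolding codifferential_odd_comps[OF lin c] by auto
  have fvw: "f1 * v + f2 * w = 0"
  proof -
    have "fps_X ^ (m + 1) * (f1 * v + f2 * w) = 0"
      using eqs(2) unfolding h1v h2w by (simp only: algebra_simps)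
    then show ?thesis using X0 by (simp only: mult_eq_0_iff simp_thms)
  qed
  have gvw: "g1 * v + g2 * w + h1 * fps_deriv w - h2 * fps_deriv v = 0"
  proof -
    \<comment> \<open>The terms with the derivative of x^(m+1) cancel because h1 w = h2 v.\<close>
    have "fps_X ^ (m + 1) * (g1 * v + g2 * w + h1 * fps_deriv w - h2 * fps_deriv v) =
        g1 * h1 + g2 * h2 + h1 * fps_deriv h2 - h2 * fps_deriv h1"
      unfolding h1v h2w by (simp only: fps_deriv_mult algebra_simps)
    then show ?thesis using X0 eqs(3) by (simp only: mult_eq_0_iff simp_thms)
  qed
  \<comment> \<open>Dividing the desired equation \<open>gu\<close> by x^m w leaves x u' = (s / w -
    \<lambda>) u. The bracket has zero constant term, so x can be divided out as well, giving u' = p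
    u.\<close>
  define p where "p = fps_shift 1 (s * inverse w - fps_const l)"
  have "fps_X * p = s * inverse w - fps_const l"
    unfolding p_def using fps_eq_X_power_times[of 1 "s * inverse w - fps_const l"] w0 s0 by simp
  then have "w * (fps_X * p + fps_const l) = s * (w * inverse w)"
    by (simp add: mult_ac)
  then have p: "s = w * (fps_X * p + fps_const l)"
    using w0 by (simp add: inverse_mult_eq_1')
  obtain u where u: "fps_nth u 0 = 1" "fps_deriv u = p * u"
    by (rule fps_linear_ode)
  have gu: "g1 * u - h2 * fps_deriv u = u * w * (fps_const l * fps_X ^ m)"
    unfolding g1s h2w p u(2) by (simp add: algebra_simps)
  have fu: "fps_X * fps_deriv (f1 * u) = - fps_const l * (f1 * u)"
  proof -
    \<comment> \<open>The left side is \<open>h2\<close> times the derivative of f1 u. The product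
      rule exposes the t2 part of Q^2 t1, which is zero, and the left side of
      \<open>gu\<close>.\<close>
    have "fps_X ^ m * w * (fps_X * fps_deriv (f1 * u)) =
        u * (f1 * g1 + h2 * fps_deriv f1) - f1 * (g1 * u - h2 * fps_deriv u)"
      by (simp add: h2w fps_deriv_mult algebra_simps)
    also have "\<dots> = fps_X ^ m * w * (- fps_const l * (f1 * u))"
      unfolding eqs(1) gu by (simp add: algebra_simps flip: fps_const_neg)
    finally have "fps_X ^ m * w * (fps_X * fps_deriv (f1 * u)) =
      fps_X ^ m * w * (- fps_const l * (f1 * u))" .
    moreover have "fps_X ^ m * w \<noteq> 0" using w0 by auto
    ultimately show ?thesis by (metis mult_left_cancel)
  qed
  have "fps_nth (f1 * u) k = 0" if "k < m + 3" for k
    using that by (simp add: fps_mult_nth f1)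
  with lin c u(1) w0 h1v h2w fvw gvw gu fu that show ?thesis by blast
qed

text \<open>The intertwining relation is checked on an arbitrary function, one part at a time. The
  constant term of \<open>u\<close> may be any nonzero scalar, so that the coefficient of a monomial
  \<open>f1 * u\<close> can be normalised as well.\<close>

lemma equivalent_normal_form:
  fixes d d' :: "'k::field_char_0 SW \<Rightarrow> 'k W"
  assumes "lin d" "lin d'" and c: "odd_comps d f1 g1 f2 g2 h1 h2"
    and c': "odd_comps d' (f1 * u) (fps_const l * fps_X ^ m) 0 0 0 (fps_X ^ (m + 1))"
    and u0: "fps_nth u 0 \<noteq> 0" and w0: "fps_nth w 0 = 1"
    and h1: "h1 = fps_X ^ (m + 1) * v" and h2: "h2 = fps_X ^ (m + 1) * w"
    and fvw: "f1 * v + f2 * w = 0"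
    and gvw: "g1 * v + g2 * w + h1 * fps_deriv w - h2 * fps_deriv v = 0"
    and gu: "g1 * u - h2 * fps_deriv u = u * w * (fps_const l * fps_X ^ m)"
  shows "equivalent d d'"
proof (rule equivalent_by_coord[OF assms(1,2) u0, of w v])
  show "fps_nth w 0 \<noteq> 0" using w0 by simp
  fix f :: "'k sf"
  obtain a b c e where f: "f = (a, b, c, e)" by (cases f) auto
  have f2w: "f2 * w = - (f1 * v)" using fvw by (simp add: eq_neg_iff_add_eq_0 add.commute)
  have "f1 * (u * b + v * c) + f2 * (w * c) = f1 * u * b"
    using f2w by (simp add: algebra_simps flip: mult.assoc[of f2])
  moreover have "h1 * fps_deriv a - f2 * (u * w * e) =
      u * 0 + v * (f1 * u * e + fps_X ^ (m + 1) * fps_deriv a)"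
  proof -
    have "h1 * fps_deriv a - f2 * (u * w * e) = h1 * fps_deriv a - (f2 * w) * (u * e)"
      by (simp only: algebra_simps)
    then show ?thesis unfolding f2w h1 by (simp add: algebra_simps)
  qed
  moreover have "f1 * (u * w * e) + h2 * fps_deriv a =
      w * (f1 * u * e + fps_X ^ (m + 1) * fps_deriv a)"
    unfolding h2 by (simp add: algebra_simps)
  moreover have "g1 * (u * b + v * c) + g2 * (w * c) + h1 * fps_deriv (w * c) -
      h2 * fps_deriv (u * b + v * c) =
      u * w * (fps_const l * fps_X ^ m * b - fps_X ^ (m + 1) * fps_deriv b)"
  proof -
    have "g1 * (u * b + v * c) + g2 * (w * c) + h1 * fps_deriv (w * c) -
      h2 * fps_deriv (u * b + v * c) =
      (g1 * u - h2 * fps_deriv u) * b - h2 * u * fps_deriv b +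
      (g1 * v + g2 * w + h1 * fps_deriv w - h2 * fps_deriv v) * c +
      (h1 * w - h2 * v) * fps_deriv c"
      by (simp add: algebra_simps)
    \<comment> \<open>The coefficient of c vanishes by \<open>gvw\<close>, that of its derivative
      because h1 w = h2 v.\<close>
    also have "\<dots> = u * w * (fps_const l * fps_X ^ m) * b - h2 * u * fps_deriv b"
      unfolding gu gvw by (simp add: h1 h2 algebra_simps)
    finally show ?thesis by (simp add: h2 algebra_simps)
  qed
  ultimately show "vector_field d (coord u v w f) = coord u v w (vector_field d' f)"
    by (simp add: f vector_field_odd[OF c] vector_field_odd[OF c'])
qed

text \<open>The Euler operator multiplies x^i by i, and distinct integers stay distinct in
  characteristic zero, so an eigenvector is a single monomial.\<close>

lemma fps_euler_eigenvector:
  fixes e :: "'k::field_char_0 fps"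
  assumes "fps_X * fps_deriv e = - fps_const l * e" "e \<noteq> 0"
  obtains k c where "c \<noteq> 0" "e = fps_const c * fps_X ^ k" "l = - of_nat k"
proof -
  have eq: "of_nat i * fps_nth e i = - l * fps_nth e i" for i
    using arg_cong[OF assms(1), of "\<lambda>f. fps_nth f i"]
    by (cases i) (simp_all add: fps_mult_left_const_nth)
  obtain k where k: "fps_nth e k \<noteq> 0" using assms(2) fps_nonzero_nth by blast
  have l: "l = - of_nat k"
    using eq[of k] k by (metis minus_minus mult_right_cancel)
  have "fps_nth e i = 0" if "i \<noteq> k" for i
    using eq[of i] that by (simp add: l)
  then have "e = fps_const (fps_nth e k) * fps_X ^ k"
    by (intro fps_ext) (simp add: fps_mult_left_const_nth)
  with k l that show ?thesis by blast
qed

lemma extension_classification: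
  fixes l :: "'k::field_char_0"
  assumes ext: "is_extension (m + 2) (d_lam m l) d"
  shows "equivalent d (d_lam m l) \<or>
    (\<exists>n>m. l = - (of_nat n + 2) \<and> equivalent d (d_lam_e m n))"
proof -
  obtain f1 g1 f2 g2 h1 h2 u v w where lin: "lin d" and c: "odd_comps d f1 g1 f2 g2 h1 h2"
    and u0: "fps_nth u 0 = 1" and w0: "fps_nth w 0 = 1"
    and h: "h1 = fps_X ^ (m + 1) * v" "h2 = fps_X ^ (m + 1) * w"
    and fg: "f1 * v + f2 * w = 0" "g1 * v + g2 * w + h1 * fps_deriv w - h2 * fps_deriv v = 0"
    and gu: "g1 * u - h2 * fps_deriv u = u * w * (fps_const l * fps_X ^ m)"
    and fu: "fps_X * fps_deriv (f1 * u) = - fps_const l * (f1 * u)"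
    and low: "\<And>k. k < m + 3 \<Longrightarrow> fps_nth (f1 * u) k = 0"
    using extension_normal_form[OF ext] by metis
  show ?thesis
  proof (cases "f1 * u = 0")
    case True
    have "equivalent d (d_lam m l)"
      by (rule equivalent_normal_form[OF lin lin_d_lam c _ _ w0 h fg gu])
         (use u0 odd_comps_d_lam True in auto)
    then show ?thesis ..
  next
    case False
    then obtain k a where a: "a \<noteq> 0" and e: "f1 * u = fps_const a * fps_X ^ k" and l: "l = - of_nat k"
      using fps_euler_eigenvector[OF fu] by metis
    have "k \<ge> m + 3" using low[of k] a by (force simp: e)
    \<comment> \<open>The order bound k \<ge> m + 3 makes the subtraction exact and yields n >
      m.\<close>
    define n where "n = k - 2"
    have n: "k = n + 2" "n > m" using \<open>k \<ge> m + 3\<close> by (auto simp: n_def)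
    have ln: "l = - (of_nat n + 2)" using l n(1) by simp
    \<comment> \<open>The equation \<open>gu\<close> is linear in \<open>u\<close> and survives the
      rescaling, which turns f1 u = a x^k into x^k.\<close>
    define u' where "u' = fps_const (inverse a) * u"
    have "f1 * u' = fps_const (inverse a) * (f1 * u)"
      by (simp only: u'_def mult_ac)
    also have "\<dots> = (fps_const (inverse a) * fps_const a) * fps_X ^ k"
      by (simp only: e mult.assoc)
    also have "\<dots> = fps_X ^ (n + 2)"
      using a n by simp
    finally have "f1 * u' = fps_X ^ (n + 2)" .
    moreover have "g1 * u' - h2 * fps_deriv u' = u' * w * (fps_const l * fps_X ^ m)"
    proof -
      have "g1 * u' - h2 * fps_deriv u' = fps_const (inverse a) * (g1 * u - h2 * fps_deriv u)"
        by (simp add: u'_def algebra_simps)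
      then show ?thesis by (simp add: gu u'_def mult_ac)
    qed
    ultimately have "equivalent d (d_lam_e m n)"
      using odd_comps_d_lam_e[of m n] a u0 ln
      by (intro equivalent_normal_form[where u = u' and l = l, OF lin lin_d_lam_e c _ _ w0 h fg])
         (auto simp: u'_def simp del: power_Suc)
    with n ln show ?thesis by blast
  qed
qed

section \<open>Non-equivalence\<close>

lemma independent_single:
  fixes A :: "'b set"
  shows "\<not> module.dependent (scl :: 'k::field \<Rightarrow> _) ((\<lambda>b. Poly_Mapping.single b 1) ` A)"
proof -
  interpret vector_space "scl :: 'k \<Rightarrow> ('b \<Rightarrow>\<^sub>0 'k) \<Rightarrow> _" by (rule vector_space_scl)
  have inj: "inj_on (\<lambda>b. Poly_Mapping.single b (1 :: 'k)) B" for B :: "'b set"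
    by (rule inj_onI) (metis lookup_single_eq lookup_single_not_eq zero_neq_one)
  show ?thesis
    unfolding dependent_explicit
  proof (clarify)
    fix t u b
    assume t: "finite t" "t \<subseteq> (\<lambda>b. Poly_Mapping.single b (1 :: 'k)) ` A"
      and 0: "(\<Sum>v\<in>t. scl (u v) v) = 0" and b: "b \<in> t" "u b \<noteq> 0"
    obtain B where B: "t = (\<lambda>b. Poly_Mapping.single b 1) ` B" "B \<subseteq> A"
      using t(2) by (meson subset_imageE)
    have "finite B" using t(1) inj by (simp add: B(1) finite_image_iff)
    obtain c where c: "c \<in> B" "b = Poly_Mapping.single c 1" using b B by blast
    have "(\<Sum>v\<in>t. scl (u v) v) = (\<Sum>b\<in>B. scl (u (Poly_Mapping.single b 1)) (Poly_Mapping.single b 1))"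
      unfolding B(1) by (simp add: sum.reindex[OF inj])
    then have "0 = pairing (\<lambda>a. if a = c then 1 else 0)
        (\<Sum>b\<in>B. scl (u (Poly_Mapping.single b 1)) (Poly_Mapping.single b 1))"
      using 0 by simp
    also have "\<dots> = (\<Sum>b\<in>B. if b = c then u (Poly_Mapping.single b 1) else 0)"
      by (simp only: pairing_sum pairing_scl pairing_single) (rule sum.cong, auto)
    also have "\<dots> = u b" using c \<open>finite B\<close> by simp
    finally show False using b by simp
  qed
qed

text \<open>The images of the basis vectors over \<open>A\<close> are independent and lie in the
  span of the basis vectors over \<open>B\<close>.\<close>

lemma card_le_of_inj_lin_image:
  fixes g :: "('b \<Rightarrow>\<^sub>0 'k::field) \<Rightarrow> ('c \<Rightarrow>\<^sub>0 'k)"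
  assumes "lin g" "inj g" "finite B"
    and im: "\<And>a. a \<in> A \<Longrightarrow> keys (g (Poly_Mapping.single a 1)) \<subseteq> B"
  shows "card A \<le> card B"
proof -
  interpret g: Vector_Spaces.linear "scl :: 'k \<Rightarrow> ('b \<Rightarrow>\<^sub>0 'k) \<Rightarrow> _" "scl :: 'k \<Rightarrow> ('c \<Rightarrow>\<^sub>0 'k) \<Rightarrow> _" g
    by (rule assms(1))
  let ?S = "(\<lambda>b. Poly_Mapping.single b (1 :: 'k)) ` A"
  let ?T = "(\<lambda>b. Poly_Mapping.single b (1 :: 'k)) ` B"
  have inj: "inj (\<lambda>b. Poly_Mapping.single b (1 :: 'k) :: 'b \<Rightarrow>\<^sub>0 'k)"
    by (rule injI) (metis lookup_single_eq lookup_single_not_eq zero_neq_one)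
  have "g.vs2.independent (g ` ?S)"
    using independent_single assms(2)
    by (intro g.independent_injective_image) (auto intro: inj_on_subset)
  moreover have "g ` ?S \<subseteq> g.vs2.span ?T"
  proof clarify
    fix a assume "a \<in> A"
    let ?y = "g (Poly_Mapping.single a 1)"
    have "?y = (\<Sum>b\<in>keys ?y. scl (lookup ?y b) (Poly_Mapping.single b 1))"
      by (rule pairing_eqI) (simp add: pairing_def[of _ ?y])
    moreover have "(\<Sum>b\<in>keys ?y. scl (lookup ?y b) (Poly_Mapping.single b 1)) \<in> g.vs2.span ?T"
      using im[OF \<open>a \<in> A\<close>]
      by (intro g.vs2.span_sum g.vs2.span_scale g.vs2.span_base) auto
    ultimately show "?y \<in> g.vs2.span ?T" by simp
  qed
  ultimately have "card (g ` ?S) \<le> card ?T"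
    using g.vs2.independent_span_bound assms(3) by blast
  moreover have "card (g ` ?S) = card A"
    using inj assms(2) by (simp add: card_image inj_on_subset)
  moreover have "card ?T \<le> card B"
    using assms(3) by (rule card_image_le)
  ultimately show ?thesis by simp
qed

text \<open>Odd monomials are excluded by parity. The coefficient of w1 w2 w3^j is seen by a product
  of two odd functions. The transpose \<open>G\<close> of \<open>g\<close> is multiplicative and
  keeps parity, so it yields again a product of odd functions, whose part free of t1 and t2 is zero;
  w3^k sees nothing else.\<close>

lemma keys_coalgebra_morphism_W3:
  fixes g :: "'k::field_char_0 SW \<Rightarrow> 'k SW"
  assumes lin: "lin g" and even: "even_map mon_odd mon_odd g"
    and comult: "\<And>x. comult (g x) = tensor_map g g (comult x)" and "k \<ge> 1"
  shows "keys (g (Poly_Mapping.single (Mon (0, 0, k)) 1)) \<subseteq> {Mon (0, 0, j) | j. j \<ge> 1}"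
proof
  let ?y = "g (Poly_Mapping.single (Mon (0, 0, k)) 1)"
  fix I assume I: "I \<in> keys ?y"
  define G where "G f = sf_of (\<lambda>I. pairing (wt f) (g (Poly_Mapping.single I 1)))" for f
  have G0: "sf_coeff (G f) (0, 0, 0) = 0" for f
    unfolding G_def by (rule sf_of_0)
  have G: "pairing (wt f) (g x) = pairing (wt (G f)) x" for f x
    unfolding G_def wt_sf_of by (rule pairing_lin[OF lin])
  have G_mult: "pairing (wt (f \<odot> h)) (g x) = pairing (wt (G f \<odot> G h)) x"
    if "sf_coeff f (0, 0, 0) = 0" "sf_coeff h (0, 0, 0) = 0" for f h x
    using pairing_comult[OF that, of "g x"] pairing_comult[OF G0 G0, of f h x]
    by (simp add: comult pairing_tensor_map G)
  have odd: "fst (G (0, b, c, 0)) = 0" for b c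
  proof -
    have "wt (G (0, b, c, 0)) I = 0" if "\<not> mon_odd I" for I
    proof -
      have "homogeneous mon_odd False (g (Poly_Mapping.single I 1))"
        using even that unfolding even_map_def by (simp add: homogeneous_single)
      moreover have "wt (0, b, c, 0) J = 0" if "\<not> mon_odd J" for J
      proof -
        obtain i j k where e: "exponents J = (i, j, k)" by (cases "exponents J") auto
        from exponents_le[OF this] have "i = 0 \<or> i = 1" "j = 0 \<or> j = 1" by auto
        then show ?thesis using that e by (auto simp: wt_eq_coeff mon_odd_def)
      qed
      ultimately show ?thesis
        by (auto simp: G_def homogeneous_def intro!: pairing_eq_0)
    qed
    note 0 = this
    obtain p q r s where f: "G (0, b, c, 0) = (p, q, r, s)" by (cases "G (0, b, c, 0)") auto
    have "fps_nth p n = 0" for n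
      using 0[of "Mon (0, 0, n)"] G0[of "(0, b, c, 0)"]
      by (cases n) (simp_all add: mon_odd_Mon wt_eq_coeff exponents_Mon f del: fact_Suc)
    then show ?thesis by (simp add: f fps_eq_iff)
  qed
  have "lookup ?y (Mon (1, 1, j)) = 0" for j
  proof -
    have "wt (0, 0, 0, fps_X ^ j) I = (if I = Mon (1, 1, j) then fact j else (0 :: 'k))" for I
    proof -
      obtain i i' l where I: "I = Mon (i, i', l)" "i \<le> 1" "i' \<le> 1" "i + i' + l \<ge> 1"
        by (rule Mon_cases)
      then have "I = Mon (1, 1, j) \<longleftrightarrow> (i, i', l) = (1, 1, j)"
        by (simp add: Mon_eq_iff)
      moreover have "i = 0 \<or> i = 1" "i' = 0 \<or> i' = 1" using I by auto
      ultimately show ?thesis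
        using I by (auto simp: wt_eq_coeff exponents_Mon simp del: fact_Suc)
    qed
    then have "wt (0, 0, 0, fps_X ^ j) = (\<lambda>I. if I = Mon (1, 1, j) then fact j else (0 :: 'k))"
      by (rule ext)
    then have "lookup ?y (Mon (1, 1, j)) * fact j = pairing (wt (0, 0, 0, fps_X ^ j)) ?y"
      by (simp only: pairing_delta_times)
    \<comment> \<open>The factorisation of x^j t1 t2 into the odd functions t1 and x^j t2.\<close>
    also have "(0, 0, 0, fps_X ^ j) = (0, 1, 0, 0) \<odot> (0, 0, fps_X ^ j, 0 :: 'k fps)"
      by simp
    also have "pairing (wt \<dots>) ?y = fact k *
        sf_coeff (G (0, 1, 0, 0) \<odot> G (0, 0, fps_X ^ j, 0)) (0, 0, k)"
      using assms(4) by (subst G_mult) (simp_all add: wt_eq_coeff exponents_Mon)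
    also have "\<dots> = 0"
      using odd[of 1 0] odd[of 0 "fps_X ^ j"]
      by (cases "G (0, 1, 0, 0)"; cases "G (0, 0, fps_X ^ j, 0)") simp
    finally show ?thesis by simp
  qed
  moreover have "\<not> mon_odd I"
  proof -
    have "homogeneous mon_odd False (Poly_Mapping.single (Mon (0, 0, k)) (1 :: 'k))"
      using assms(4) by (intro homogeneous_single) (simp add: mon_odd_Mon)
    then show ?thesis
      using even I unfolding even_map_def homogeneous_def by blast
  qed
  moreover obtain i i' l where Il: "I = Mon (i, i', l)" "i \<le> 1" "i' \<le> 1" "i + i' + l \<ge> 1"
    by (rule Mon_cases)
  moreover have "i = 0 \<or> i = 1" "i' = 0 \<or> i' = 1" using Il by auto
  ultimately show "I \<in> {Mon (0, 0, j) | j. j \<ge> 1}"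
    using I by (auto simp: mon_odd_Mon in_keys_iff)
qed

text \<open>The coderivation of \<open>d_lam\<close> kills every w3^k, so that of
  \<open>d_lam_e\<close> kills g(w3^k). Testing this against t1 x^j removes w3^(n+2+j) from g(w3^k)
  for all j, which leaves n + 1 possible monomials for n + 2 independent images.\<close>

lemma not_equivalent_d_lam_e:
  fixes l :: "'k::field_char_0"
  shows "\<not> equivalent (d_lam_e m n) (d_lam m l)"
proof
  assume "equivalent (d_lam_e m n) (d_lam m l)"
  then obtain g where g: "coalgebra_automorphism g"
    and eq: "coder (d_lam m l) = inv g \<circ> coder (d_lam_e m n) \<circ> g"
    unfolding equivalent_def by blast
  have lin: "lin g" and bij: "bij g" and even: "even_map mon_odd mon_odd g"
    and comult: "\<And>x. comult (g x) = tensor_map g g (comult x)"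
    using g by (auto simp: coalgebra_automorphism_def)
  have "keys (g (Poly_Mapping.single a 1)) \<subseteq> (\<lambda>j. Mon (0, 0, j)) ` {1..n + 1}"
    if "a \<in> (\<lambda>k. Mon (0, 0, k)) ` {1..n + 2}" for a
  proof -
    from that obtain k where a: "a = Mon (0, 0, k)" and k: "k \<ge> 1" by auto
    let ?x = "Poly_Mapping.single a (1 :: 'k)"
    have keys: "keys (g ?x) \<subseteq> {Mon (0, 0, j) | j. j \<ge> 1}"
      unfolding a by (rule keys_coalgebra_morphism_W3[OF lin even comult k])
    have "coder (d_lam m l) ?x = 0"
    proof (rule pairing_wt_eqI)
      fix f :: "'k sf"
      show "pairing (wt f) (coder (d_lam m l) ?x) = pairing (wt f) 0"
        using k by (cases f) (simp add: pairing_coder[OF lin_d_lam]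
            vector_field_odd[OF odd_comps_d_lam] a wt_eq_coeff exponents_Mon)
    qed
    then have "inv g (coder (d_lam_e m n) (g ?x)) = 0" by (simp add: eq)
    then have "coder (d_lam_e m n) (g ?x) = g 0"
      using bij by (metis bij_inv_eq_iff)
    also have "g 0 = 0"
      using lin unfolding lin_iff by (metis add_cancel_right_right)
    finally have 0: "coder (d_lam_e m n) (g ?x) = 0" .
    have "lookup (g ?x) (Mon (0, 0, n + 2 + j)) = 0" for j
    proof -
      \<comment> \<open>The t1 t2 part of the vector field applied to t1 x^j. It drops out because
        \<open>g ?x\<close> involves only powers of w3.\<close>
      let ?q = "fps_const (- (of_nat n + 2)) * fps_X ^ m * fps_X ^ j -
          fps_X ^ (m + 1) * fps_deriv (fps_X ^ j) :: 'k fps"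
      have "0 = pairing (wt (fps_X ^ (n + 2) * fps_X ^ j, 0, 0, ?q)) (g ?x)"
        using arg_cong[OF 0, of "pairing (wt (0, fps_X ^ j, 0, 0))"]
        by (simp only: pairing_coder[OF lin_d_lam_e] vector_field_odd[OF odd_comps_d_lam_e]) simp
      also have "\<dots> = pairing (\<lambda>I. if I = Mon (0, 0, n + 2 + j) then fact (n + 2 + j) else 0) (g ?x)"
        unfolding pairing_def
      proof (rule sum.cong[OF refl])
        fix I assume "I \<in> keys (g ?x)"
        with keys obtain i where I: "I = Mon (0, 0, i)" "i \<ge> 1" by auto
        then have "I = Mon (0, 0, n + 2 + j) \<longleftrightarrow> i = n + 2 + j"
          by (simp add: Mon_eq_iff)
        then show "lookup (g ?x) I * wt (fps_X ^ (n + 2) * fps_X ^ j, 0, 0, ?q) I =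
            lookup (g ?x) I * (if I = Mon (0, 0, n + 2 + j) then fact (n + 2 + j) else 0)"
          using I by (simp add: wt_eq_coeff exponents_Mon del: fact_Suc power_Suc flip: power_add)
      qed
      also have "\<dots> = lookup (g ?x) (Mon (0, 0, n + 2 + j)) * fact (n + 2 + j)"
        by (rule pairing_delta_times)
      finally show ?thesis by (metis fact_nonzero mult_eq_0_iff)
    qed
    then have out: "Mon (0, 0, j) \<notin> keys (g ?x)" if "j \<ge> n + 2" for j
      using that by (metis in_keys_iff le_Suc_ex)
    show ?thesis
    proof
      fix I assume I: "I \<in> keys (g ?x)"
      with keys obtain j where j: "I = Mon (0, 0, j)" "j \<ge> 1" by auto
      with I out[of j] have "j \<le> n + 1" by force
      with j show "I \<in> (\<lambda>j. Mon (0, 0, j)) ` {1..n + 1}" by simp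
    qed
  qed
  then have "card ((\<lambda>k. Mon (0, 0, k)) ` {1..n + 2}) \<le> card ((\<lambda>k. Mon (0, 0, k)) ` {1..n + 1})"
    using bij by (intro card_le_of_inj_lin_image[OF lin]) (auto simp: bij_is_inj)
  moreover have "inj_on (\<lambda>k. Mon (0, 0, k)) {1..N}" for N
    by (rule inj_onI) (metis atLeastAtMost_iff add_0 exponents_Mon le0 prod.inject)
  ultimately show False by (simp add: card_image)
qed

theorem mainTheorem3:
  fixes m :: nat and l :: "'k :: {alg_closed_field, field_char_0}"
  shows "((\<nexists>n. n > m \<and> l = - (of_nat n + 2)) \<longrightarrow>
            (\<forall>d. is_extension (m + 2) (d_lam m l) d \<longrightarrow> equivalent d (d_lam m l)))
       \<and> (\<forall>n. n > m \<and> l = - (of_nat n + 2) \<longrightarrow>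
            is_extension (m + 2) (d_lam m l) (d_lam_e m n)
          \<and> \<not> equivalent (d_lam_e m n) (d_lam m l)
          \<and> (\<forall>d. is_extension (m + 2) (d_lam m l) d \<longrightarrow>
                 equivalent d (d_lam m l) \<or> equivalent d (d_lam_e m n)))"
proof (intro conjI allI impI; (elim conjE)?)
  fix d assume "\<nexists>n. n > m \<and> l = - (of_nat n + 2)" "is_extension (m + 2) (d_lam m l) d"
  then show "equivalent d (d_lam m l)"
    using extension_classification by blast
next
  fix n assume "n > m" "l = - (of_nat n + 2)"
  then show "is_extension (m + 2) (d_lam m l) (d_lam_e m n)"
    by (simp only: is_extension_d_lam_e)
next
  fix n show "\<not> equivalent (d_lam_e m n) (d_lam m l)"
    by (rule not_equivalent_d_lam_e)
next
  fix n d
  assume l: "l = - (of_nat n + 2)" and "is_extension (m + 2) (d_lam m l) d"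
  \<comment> \<open>The integer delivered by the classification must be the given n, since \<lambda>
    determines it in characteristic zero.\<close>
  from extension_classification[OF this(2)]
  show "equivalent d (d_lam m l) \<or> equivalent d (d_lam_e m n)"
    by (auto simp: l)
qed

end
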